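(* Let $f\colon\mathbb{R}^d\to\mathbb{R}$ be a differentiable $\rho$-weakly convex function ($\rho\ge0$) with $\ell$-Lipschitz continuous gradient, let $g\colon\mathbb{R}^d\to\mathbb{R}$ be continuous and convex, let $h\colon\mathbb{R}^d\to(-\infty,+\infty]$ be lower semicontinuous, and suppose $F=f+h-g$ is coercive. Let $\nu\in(0,2)$, $\tau\in(0,+\infty)$ and $$0<\gamma<\overline\gamma:=\frac{-\nu\rho+\sqrt{\nu^2\rho^2-8(\nu-2)\ell^2}}{4\ell^2}$$ (with $\overline\gamma=+\infty$ if $\ell=0$). Let $(x_n,y_n,z_n,w_n)_{n\in\mathbb{N}^*}$ be generated by the Backward-Douglas--Rachford algorithm: starting from $y_0,z_0,w_0\in\mathbb{R}^d$, for every $n\in\mathbb{N}$, \begin{align*} x_{n+1} &\in \operatorname{argmin}_{x}\Big(f(x)+\tfrac{1}{2\gamma}\|x-y_n\|^2\Big),\\ w_{n+1} &= \operatorname{argmin}_{w}\Big(g^*(w)-\langle w,z_n\rangle+\tfrac{\tau}{2}\|w-w_n\|^2\Big),\\ z_{n+1} &\in \operatorname{argmin}_{z}\Big(h(z)+\tfrac{1}{2\gamma}\|z-(2x_{n+1}-y_n+\gamma w_{n+1})\|^2\Big),\\ y_{n+1} &= y_n+\nu(z_{n+1}-x_{n+1}). \end{align*} Define $\mathcal{F}(x,y,z,w)=f(x)+h(z)+g^*(w)-\langle w,z\rangle+\tfrac{1}{2\gamma}\|x-y\|^2-\tfrac{1}{2\gamma}\|y-z\|^2+\tfrac{1-\nu}{\gamma}\|x-z\|^2$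 on $(\mathbb{R}^d)^4$. (i) If $\mathcal{F}$ is a KL function, then $(x_n,y_n,z_n,w_n)$ converges to some $(x^*,y^*,z^*,w^* )$ with $x^*=z^*$ and $0\in\nabla f(z^* )+\partial h(z^* )-\partial g(z^* )$, and $\sum_{n}\|(x_{n+1},y_{n+1},z_{n+1},w_{n+1})-(x_n,y_n,z_n,w_n)\|<+\infty$. (ii) Suppose $\mathcal{F}$ is a KL function with exponent $\theta\in[0,1)$, and let $(x^*,y^*,z^*,w^* )$ be the limit from (i). Then: (a) if $\theta=0$, $(x_n,y_n,z_n,w_n)$ converges to $(x^*,y^*,z^*,w^* )$ in finitely many steps; (b) if $\theta\in(0,\frac12]$, there exist $\Gamma>0$ and $\zeta\in(0,1)$ such that for all $n\in\mathbb{N}^*$, $\|(x_n,y_n,z_n,w_n)-(x^*,y^*,z^*,w^* )\|\le\Gamma\zeta^{n/2}$ and $|F(z_n)-F(z^* )|\le\Gamma\zeta^{n/2}$; (c) if $\theta\in(\frac12,1)$, there exists $\Gamma>0$ such that for all $n\in\mathbb{N}^*$, $\|(x_n,y_n,z_n,w_n)-(x^*,y^*,z^*,w^* )\|\le\Gamma n^{-\frac{1-\theta}{2\theta-1}}$ and $|F(z_n)-F(z^* )|\le\Gamma n^{-\frac{1-\theta}{2\theta-1}}$.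
   Context: $f$ is $\rho$-weakly convex if $f+\frac{\rho}{2}\|\cdot\|^2$ is convex; $F$ coercive means $F(x)\to+\infty$ as $\|x\|\to\infty$; $g^*$ is the Fenchel conjugate of $g$. For a function $\phi$, the limiting subdifferential $\partial\phi(x)$ is the set of $x^*$ such that there exist $x_k\to x$ with $\phi(x_k)\to\phi(x)$ and $x_k^*\to x^*$, $x_k^*\in\widehat\partial\phi(x_k)$, where $\widehat\partial\phi(x)=\{x^*:\liminf_{y\to x}\frac{\phi(y)-\phi(x)-\langle x^*,y-x\rangle}{\|y-x\|}\ge0\}$ (empty if $|\phi(x)|=\infty$); for convex $g$ it is the convex subdifferential. A proper lower semicontinuous $\phi$ satisfies the KL property at $\bar x\in\operatorname{dom}\partial\phi$ if there exist $\eta\in(0,+\infty]$, a neighborhood $V$ of $\bar x$, and a continuous concave $\varphi\colon[0,\eta)\to\mathbb{R}_+$, continuously differentiable with $\varphi'>0$ on $(0,\eta)$ and $\varphi(0)=0$, such that $\varphi'(\phi(x)-\phi(\bar x))\operatorname{dist}(0,\partial\phi(x))\ge1$ for all $x\in V$ with $\phi(\bar x)<\phi(x)<\phi(\bar x)+\eta$. $\phi$ is a KL function if this holds at every point of $\operatorname{dom}\partial\phi$; it is a KL function with exponent $\theta\in[0,1)$ if moreover $\varphi$ can be taken as $\varphi(t)=ct^{1-\theta}$ ($c>0$) at every such point. $\mathbb{N}^*=\{1,2,\dots\}$. *)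

theory Defs
  imports "HOL-Analysis.Analysis"
begin

definition lsc :: "('a::topological_space \<Rightarrow> ereal) \<Rightarrow> bool" where
  "lsc \<phi> \<longleftrightarrow> (\<forall>x. \<phi> x \<le> Liminf (at x) \<phi>)"

definition is_argmin :: "('a \<Rightarrow> 'b::linorder) \<Rightarrow> 'a \<Rightarrow> bool" where
  "is_argmin \<phi> x \<longleftrightarrow> (\<forall>y. \<phi> x \<le> \<phi> y)"

definition fenchel_conj :: "('a::real_inner \<Rightarrow> real) \<Rightarrow> 'a \<Rightarrow> ereal" where
  "fenchel_conj g w = (SUP x. ereal (inner w x - g x))"

definition frechet_subdiff :: "('a::real_inner \<Rightarrow> ereal) \<Rightarrow> 'a \<Rightarrow> 'a set" where
  "frechet_subdiff \<phi> x =
     (if \<bar>\<phi> x\<bar> = \<infinity> then {}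
      else {s. Liminf (at x) (\<lambda>y. (\<phi> y - \<phi> x - ereal (inner s (y - x))) / ereal (norm (y - x))) \<ge> 0})"

definition limiting_subdiff :: "('a::real_inner \<Rightarrow> ereal) \<Rightarrow> 'a \<Rightarrow> 'a set" where
  "limiting_subdiff \<phi> x =
     {s. \<exists>xk sk. xk \<longlonglongrightarrow> x \<and> (\<lambda>k. \<phi> (xk k)) \<longlonglongrightarrow> \<phi> x \<and> sk \<longlonglongrightarrow> s
              \<and> (\<forall>k. sk k \<in> frechet_subdiff \<phi> (xk k))}"

definition dom_subdiff :: "('a::real_inner \<Rightarrow> ereal) \<Rightarrow> 'a set" where
  "dom_subdiff \<phi> = {x. limiting_subdiff \<phi> x \<noteq> {}}"

definition desing :: "ereal \<Rightarrow> (real \<Rightarrow> real) \<Rightarrow> (real \<Rightarrow> real) \<Rightarrow> bool" where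
  "desing \<eta> vphi vphi' \<longleftrightarrow>
     continuous_on {t. 0 \<le> t \<and> ereal t < \<eta>} vphi
   \<and> concave_on {t. 0 \<le> t \<and> ereal t < \<eta>} vphi
   \<and> (\<forall>t. 0 \<le> t \<and> ereal t < \<eta> \<longrightarrow> vphi t \<ge> 0)
   \<and> vphi 0 = 0
   \<and> (\<forall>t. 0 < t \<and> ereal t < \<eta> \<longrightarrow> (vphi has_real_derivative vphi' t) (at t) \<and> vphi' t > 0)
   \<and> continuous_on {t. 0 < t \<and> ereal t < \<eta>} vphi'"

text \<open>The KL inequality at \<open>xbar\<close> on the neighborhood V, with dist(0, empty) = +\<infinity>.\<close>
definition KL_ineq :: "('a::real_inner \<Rightarrow> ereal) \<Rightarrow> 'a \<Rightarrow> ereal \<Rightarrow> 'a set \<Rightarrow> (real \<Rightarrow> real) \<Rightarrow> bool" where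
  "KL_ineq \<phi> xbar \<eta> V vphi' \<longleftrightarrow>
     (\<forall>x\<in>V. \<phi> xbar < \<phi> x \<and> \<phi> x < \<phi> xbar + \<eta> \<longrightarrow>
        ereal (vphi' (real_of_ereal (\<phi> x - \<phi> xbar)))
          * (INF s\<in>limiting_subdiff \<phi> x. ereal (norm s)) \<ge> 1)"

definition KL_at :: "('a::real_inner \<Rightarrow> ereal) \<Rightarrow> 'a \<Rightarrow> bool" where
  "KL_at \<phi> xbar \<longleftrightarrow>
     (\<exists>\<eta> V vphi vphi'. \<eta> > 0 \<and> open V \<and> xbar \<in> V \<and> desing \<eta> vphi vphi'
        \<and> KL_ineq \<phi> xbar \<eta> V vphi')"

definition KL_function :: "('a::real_inner \<Rightarrow> ereal) \<Rightarrow> bool" where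
  "KL_function \<phi> \<longleftrightarrow> (\<forall>xbar \<in> dom_subdiff \<phi>. KL_at \<phi> xbar)"

definition KL_function_exp :: "('a::real_inner \<Rightarrow> ereal) \<Rightarrow> real \<Rightarrow> bool" where
  "KL_function_exp \<phi> \<theta> \<longleftrightarrow> KL_function \<phi> \<and>
     (\<forall>xbar \<in> dom_subdiff \<phi>. \<exists>\<eta> V c. c > 0 \<and> \<eta> > 0 \<and> open V \<and> xbar \<in> V
        \<and> desing \<eta> (\<lambda>t. c * t powr (1 - \<theta>)) (\<lambda>t. c * (1 - \<theta>) * t powr (- \<theta>))
        \<and> KL_ineq \<phi> xbar \<eta> V (\<lambda>t. c * (1 - \<theta>) * t powr (- \<theta>)))"

definition BDR_merit ::
  "('a::real_inner \<Rightarrow> real) \<Rightarrow> ('a \<Rightarrow> ereal) \<Rightarrow> ('a \<Rightarrow> real) \<Rightarrow> real \<Rightarrow> real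
     \<Rightarrow> 'a \<times> 'a \<times> 'a \<times> 'a \<Rightarrow> ereal" where
  "BDR_merit f h g \<gamma> \<nu> = (\<lambda>(x, y, z, w).
      ereal (f x) + h z + fenchel_conj g w
      + ereal (- inner w z + 1 / (2 * \<gamma>) * (norm (x - y))\<^sup>2
               - 1 / (2 * \<gamma>) * (norm (y - z))\<^sup>2 + (1 - \<nu>) / \<gamma> * (norm (x - z))\<^sup>2))"

end

theory Submission
  imports Defs
begin

text \<open>
  With \<open>e\<^sub>n = z\<^sub>n - x\<^sub>n\<close> the optimality conditions of the subproblems read \<open>y\<^sub>n = x\<^sub>n\<^sub>+\<^sub>1 + \<gamma> \<nabla>f(x\<^sub>n\<^sub>+\<^sub>1)\<close> and
  \<open>w\<^sub>n\<^sub>+\<^sub>1 \<in> \<partial>g(u\<^sub>n)\<close> with \<open>u\<^sub>n = z\<^sub>n - \<tau>(w\<^sub>n\<^sub>+\<^sub>1 - w\<^sub>n)\<close>, so that \<open>\<nu> e\<^sub>n = (x\<^sub>n\<^sub>+\<^sub>1 - x\<^sub>n) + \<gamma> (\<nabla>f(x\<^sub>n\<^sub>+\<^sub>1) - \<nabla>f(x\<^sub>n))\<close>.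
  Hence every increment and a subgradient of the merit function at the \<open>n\<close>-th iterate are bounded by
  consecutive values of \<open>\<delta>\<^sub>n = \<parallel>x\<^sub>n\<^sub>+\<^sub>1 - x\<^sub>n\<parallel> + \<parallel>w\<^sub>n\<^sub>+\<^sub>1 - w\<^sub>n\<parallel>\<close>, while the merit value decreases by at least
  a multiple of \<open>\<delta>\<^sub>n\<^sup>2\<close>; the bound on \<open>\<gamma>\<close> says exactly that the coefficient of \<open>\<parallel>x\<^sub>n\<^sub>+\<^sub>1 - x\<^sub>n\<parallel>\<^sup>2\<close> is positive.
  The merit value also dominates \<open>F(z\<^sub>n)\<close>, so coercivity bounds the iterates. The KL inequality at a
  cluster point then traps the iterates near it and makes \<open>\<delta>\<close> summable. With exponent \<open>\<theta>\<close>, the merit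
  gaps \<open>r\<^sub>n\<close> satisfy \<open>r\<^sub>n\<^sub>+\<^sub>2 powr (2\<theta>) \<le> C (r\<^sub>n - r\<^sub>n\<^sub>+\<^sub>2)\<close>, which gives the rates.
\<close>

section \<open>Subgradients, conjugates and gradients\<close>

text \<open>The merit function need not be continuous in \<open>z\<close> and \<open>w\<close>, and
  this shapes two places. No sum rule for subdifferentials is used: at an iterate, \<open>f\<close>,
  \<open>h\<close> and the conjugate each have a quadratic minorant (Lipschitz gradient, proximal
  inequality, Fenchel inequality), the coupling part is a quadratic form, and adding these exhibits
  a Frechet subgradient directly. Moreover the KL inequality at a cluster point can only be used
  once the merit values are known to converge to the value there, which has to be extracted from the
  subproblems. Two consecutive \<open>\<delta>\<close> appear because the w-step uses the previous
  \<open>z\<close>: the \<open>w\<close>-block of the subgradient compares an iterate with its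
  predecessor. Paying for both costs two decreases, hence the jump from \<open>n\<close> to
  \<open>n + 2\<close> in the gap recursion. The merit value bounds \<open>F(z_n)\<close> only from
  above, so the rate for the objective needs a converse estimate, linear in the distances to the
  limit.\<close>

lemma frechet_subdiffI_quadratic:
  fixes \<phi> :: "'a::real_inner \<Rightarrow> ereal"
  assumes fin: "\<bar>\<phi> x\<bar> \<noteq> \<infinity>"
    and le: "\<And>y. \<phi> x + ereal (inner s (y - x) - K * (norm (y - x))\<^sup>2) \<le> \<phi> y"
  shows "s \<in> frechet_subdiff \<phi> x"
proof -
  obtain c where c: "\<phi> x = ereal c" using fin by auto
  have "0 \<le> Liminf (at x) (\<lambda>y. (\<phi> y - \<phi> x - ereal (inner s (y - x))) / ereal (norm (y - x)))"
    unfolding le_Liminf_iff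
  proof (intro allI impI)
    fix l :: ereal assume l: "l < 0"
    \<comment> \<open>Divided by \<open>norm (y - x)\<close>, the quadratic minorant leaves this
      error, which vanishes at \<open>x\<close>.\<close>
    have tend: "((\<lambda>y. ereal (- K * norm (y - x))) \<longlongrightarrow> ereal (- K * norm (x - x))) (at x)"
      by (intro tendsto_intros)
    have "\<forall>\<^sub>F y in at x. l < ereal (- K * norm (y - x))"
      using tend l by (intro order_tendstoD(1)[OF tend]) (simp add: zero_ereal_def[symmetric])
    moreover have "\<forall>\<^sub>F y in at x. y \<noteq> x" by (simp add: eventually_at_filter)
    ultimately show "\<forall>\<^sub>F y in at x. l < (\<phi> y - \<phi> x - ereal (inner s (y - x))) / ereal (norm (y - x))"
    proof eventually_elim
      case (elim y)
      then have n: "norm (y - x) > 0" by simp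
      have "ereal (- K * norm (y - x)) \<le> (\<phi> y - \<phi> x - ereal (inner s (y - x))) / ereal (norm (y - x))"
      proof (cases "\<phi> y")
        case (real r)
        have "c + inner s (y - x) - K * (norm (y - x))\<^sup>2 \<le> r"
          using le[of y] c real by simp
        then have "- K * norm (y - x) * norm (y - x) \<le> r - c - inner s (y - x)"
          by (simp add: power2_eq_square algebra_simps)
        then show ?thesis using n by (simp add: c real pos_le_divide_eq)
      next
        case PInf
        then show ?thesis using n by (simp add: c)
      next
        case MInf
        then show ?thesis using le[of y] c by simp
      qed
      then show ?case using elim(1) by (rule less_le_trans[rotated])
    qed
  qed
  then show ?thesis using fin by (simp add: frechet_subdiff_def)
qed

lemma limiting_subdiff_if_frechet:
  assumes "s \<in> frechet_subdiff \<phi> x"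
  shows "s \<in> limiting_subdiff \<phi> x"
  unfolding limiting_subdiff_def
  using assms by (intro CollectI exI[of _ "\<lambda>_. x"] exI[of _ "\<lambda>_. s"]) auto

lemma lsc_tendsto_le:
  fixes h :: "'a::metric_space \<Rightarrow> ereal"
  assumes "lsc h" "X \<longlonglongrightarrow> x" "(\<lambda>n. h (X n)) \<longlonglongrightarrow> l"
  shows "h x \<le> l"
proof (rule dense_le)
  fix m assume m: "m < h x"
  have "h x \<le> Liminf (at x) h" using assms(1) by (simp add: lsc_def)
  then have "\<forall>\<^sub>F y in at x. m < h y" using m by (simp add: le_Liminf_iff)
  \<comment> \<open>\<open>lsc\<close> only looks at punctured neighbourhoods; the choice of
    \<open>m\<close> adds the point \<open>x\<close>, which the sequence may hit.\<close>
  then have "\<forall>\<^sub>F y in nhds x. m < h y" using m by (auto simp: eventually_at_filter elim: eventually_mono)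
  then have "\<forall>\<^sub>F n in sequentially. m < h (X n)"
    using assms(2) by (auto simp: filterlim_iff)
  then have "\<forall>\<^sub>F n in sequentially. m \<le> h (X n)" by (auto elim: eventually_mono)
  then show "m \<le> l" using assms(3) by (intro tendsto_lowerbound) auto
qed

text \<open>Otherwise values below every \<open>- real m\<close> occur at points that accumulate in
  \<open>K\<close>, and lower semicontinuity would force the excluded value minus infinity at an
  accumulation point.\<close>

lemma lsc_bounded_below_on_compact:
  fixes h :: "'a::metric_space \<Rightarrow> ereal"
  assumes "lsc h" "\<And>u. h u \<noteq> -\<infinity>" "compact K"
  obtains m where "\<And>u. u \<in> K \<Longrightarrow> ereal m \<le> h u"
proof -
  have "\<exists>m. \<forall>u\<in>K. ereal m \<le> h u"
  proof (rule ccontr)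
    assume "\<not> ?thesis"
    then have "\<forall>m::nat. \<exists>u\<in>K. h u < ereal (- real m)" by (auto simp: not_le)
    then obtain X where X: "\<And>m. X m \<in> K" "\<And>m. h (X m) < ereal (- real m)" by metis
    obtain l r where r: "l \<in> K" "strict_mono (r :: nat \<Rightarrow> nat)" "(X \<circ> r) \<longlonglongrightarrow> l"
      using assms(3) X(1) unfolding compact_def by meson
    have "(\<lambda>n. h ((X \<circ> r) n)) \<longlonglongrightarrow> -\<infinity>"
      unfolding tendsto_MInfty
    proof
      fix b :: real
      obtain N :: nat where N: "- b < N" using reals_Archimedean2 by blast
      have "h ((X \<circ> r) n) < ereal b" if "n \<ge> N" for n
      proof -
        have "real n \<le> real (r n)" using seq_suble[OF r(2)] by simp
        then have "ereal (- real (r n)) \<le> ereal b" using N that by simp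
        then show ?thesis using X(2)[of "r n"] by (metis comp_apply less_le_trans)
      qed
      then show "\<forall>\<^sub>F n in sequentially. h ((X \<circ> r) n) < ereal b"
        by (auto simp: eventually_sequentially)
    qed
    from lsc_tendsto_le[OF assms(1) r(3) this] show False using assms(2)[of l] by simp
  qed
  then show ?thesis using that by blast
qed

section \<open>Convex subgradients and the Fenchel conjugate\<close>

definition is_subgradient :: "('a::real_inner \<Rightarrow> real) \<Rightarrow> 'a \<Rightarrow> 'a \<Rightarrow> bool" where
  "is_subgradient g u v \<longleftrightarrow> (\<forall>t. g u + inner v (t - u) \<le> g t)"

text \<open>A hyperplane separates \<open>(u, g u)\<close> from the strict epigraph
  \<open>T\<close>; its slope is the subgradient.\<close>

lemma ex_subgradient:
  fixes g :: "'a::euclidean_space \<Rightarrow> real"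
  assumes "convex_on UNIV g"
  shows "\<exists>v. is_subgradient g u v"
proof -
  define T where "T = {(t, r). g t < r}"
  have "convex T"
    unfolding convex_def
  proof (intro ballI allI impI)
    fix p q :: "'a \<times> real" and a b :: real
    assume h: "p \<in> T" "q \<in> T" "0 \<le> a" "0 \<le> b" "a + b = 1"
    obtain t r t' r' where p: "p = (t, r)" and q: "q = (t', r')" by fastforce
    have "g (a *\<^sub>R t + b *\<^sub>R t') \<le> a * g t + b * g t'"
      using assms h by (auto simp: convex_on_def)
    also have "\<dots> < a * r + b * r'"
    proof (cases "a = 0")
      case False
      then have "a * g t < a * r" using h p by (auto simp: T_def)
      moreover have "b * g t' \<le> b * r'" using h q by (auto simp: T_def intro!: mult_left_mono)
      ultimately show ?thesis by simp
    qed (use h q in \<open>auto simp: T_def\<close>)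
    finally show "a *\<^sub>R p + b *\<^sub>R q \<in> T" by (simp add: T_def p q)
  qed
  moreover have "T \<noteq> {}" using lt_ex gt_ex by (fastforce simp: T_def)
  moreover have "{(u, g u)} \<inter> T = {}" by (simp add: T_def)
  ultimately obtain a b where ab: "a \<noteq> 0" "inner a (u, g u) \<le> b" "\<And>q. q \<in> T \<Longrightarrow> inner a q \<ge> b"
    using separating_hyperplane_sets[of "{(u, g u)}" T] by (metis convex_singleton insertI1 insert_not_empty)
  obtain a1 a2 where a: "a = (a1, a2)" by fastforce
  have le: "inner a1 u + a2 * g u \<le> inner a1 t + a2 * r" if "g t < r" for t r
    using ab(2) ab(3)[of "(t, r)"] that by (simp add: a T_def)
  have "a2 \<ge> 0" using le[of u "g u + 1"] by (simp add: algebra_simps)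
  \<comment> \<open>The hyperplane is not vertical because \<open>g\<close> is finite everywhere:
    testing it above \<open>u - a1\<close> would force \<open>a1 = 0\<close>.\<close>
  moreover have "a2 \<noteq> 0"
  proof
    assume "a2 = 0"
    then have "inner a1 u \<le> inner a1 (u - a1)"
      using le[of "u - a1" "g (u - a1) + 1"] by simp
    then have "a1 = 0"
      by (simp add: inner_diff_right) (metis inner_eq_zero_iff inner_ge_zero order_antisym)
    then show False using ab(1) a \<open>a2 = 0\<close> by (simp add: zero_prod_def)
  qed
  ultimately have a2: "a2 > 0" by simp
  have "is_subgradient g u (- (1 / a2) *\<^sub>R a1)"
    unfolding is_subgradient_def
  proof
    fix t
    have "inner a1 (u - t) / a2 + g u \<le> r" if "g t < r" for r
      using le[OF that] a2 by (simp add: field_simps inner_diff_right)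
    then have "inner a1 (u - t) / a2 + g u \<le> g t" by (rule dense_ge)
    then show "g u + inner (- (1 / a2) *\<^sub>R a1) (t - u) \<le> g t"
      by (simp add: inner_diff_right diff_divide_distrib)
  qed
  then show ?thesis ..
qed

lemma fenchel_conj_ge: "ereal (inner w x - g x) \<le> fenchel_conj g w"
  unfolding fenchel_conj_def by (rule SUP_upper) simp

lemma fenchel_conj_le_iff: "fenchel_conj g w \<le> ereal c \<longleftrightarrow> (\<forall>x. inner w x - g x \<le> c)"
  unfolding fenchel_conj_def by (simp add: SUP_le_iff)

lemma fenchel_conj_eq:
  assumes "is_subgradient g u v"
  shows "fenchel_conj g v = ereal (inner v u - g u)"
proof (rule antisym)
  show "fenchel_conj g v \<le> ereal (inner v u - g u)"
    using assms by (auto simp: fenchel_conj_le_iff is_subgradient_def inner_diff_right algebra_simps)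
qed (rule fenchel_conj_ge)

text \<open>Optimality says that \<open>u\<close> is a subgradient of the conjugate at
  \<open>a\<close>; returning to \<open>g\<close> would need biconjugation. Instead a subgradient
  \<open>v\<close> of \<open>g\<close> at \<open>u\<close> serves as comparison point: its conjugate
  value is known, and moving from \<open>a\<close> towards \<open>v\<close> yields Fenchel equality
  for \<open>a\<close> and \<open>u\<close>.\<close>

lemma argmin_conj_subgradient:
  fixes g :: "'a::euclidean_space \<Rightarrow> real"
  assumes conv: "convex_on UNIV g" and tau: "0 < \<tau>"
    and argmin: "is_argmin (\<lambda>v. fenchel_conj g v - ereal (inner v z) + ereal (\<tau> / 2 * (norm (v - w0))\<^sup>2)) a"
  shows "is_subgradient g (z - \<tau> *\<^sub>R (a - w0)) a"
proof -
  define u where "u = z - \<tau> *\<^sub>R (a - w0)"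
  obtain v where v: "is_subgradient g u v" using ex_subgradient[OF conv] by blast
  define B where "B = inner v u - g u"
  have B: "fenchel_conj g v = ereal B" using fenchel_conj_eq[OF v] by (simp add: B_def)
  have "fenchel_conj g a - ereal (inner a z) + ereal (\<tau> / 2 * (norm (a - w0))\<^sup>2) < \<infinity>"
    using argmin[unfolded is_argmin_def, rule_format, of v] B by (auto simp: less_top[symmetric] top_ereal_def)
  moreover have "fenchel_conj g a \<noteq> -\<infinity>" using fenchel_conj_ge[of a 0 g] by auto
  ultimately obtain A where A: "fenchel_conj g a = ereal A" by (cases "fenchel_conj g a") auto
  \<comment> \<open>Minimality against the point at parameter \<open>t\<close> between
    \<open>a\<close> and \<open>v\<close>, divided by \<open>t\<close>. The value \<open>B\<close>
    cancels with \<open>inner v u\<close>, and letting \<open>t\<close> tend to 0 removes the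
    right-hand side.\<close>
  have le: "A - inner a u + g u \<le> \<tau> / 2 * (norm (v - a))\<^sup>2 * t" if t: "0 < t" "t \<le> 1" for t :: real
  proof -
    define p where "p = a + t *\<^sub>R (v - a)"
    have p: "fenchel_conj g p \<le> ereal ((1 - t) * A + t * B)"
      unfolding fenchel_conj_le_iff
    proof
      fix s
      have "inner a s - g s \<le> A" "inner v s - g s \<le> B"
        using fenchel_conj_ge[of a s g] fenchel_conj_ge[of v s g] A B by auto
      then have "(1 - t) * (inner a s - g s) + t * (inner v s - g s) \<le> (1 - t) * A + t * B"
        using t by (intro add_mono mult_left_mono) auto
      then show "inner p s - g s \<le> (1 - t) * A + t * B"
        by (simp add: p_def inner_simps algebra_simps)
    qed
    have "ereal (A - inner a z + \<tau> / 2 * (norm (a - w0))\<^sup>2)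
        \<le> fenchel_conj g p + ereal (- inner p z + \<tau> / 2 * (norm (p - w0))\<^sup>2)"
      using argmin[unfolded is_argmin_def, rule_format, of p] A
      by (cases "fenchel_conj g p") auto
    also have "\<dots> \<le> ereal ((1 - t) * A + t * B + (- inner p z + \<tau> / 2 * (norm (p - w0))\<^sup>2))"
      using add_right_mono[OF p, of "ereal (- inner p z + \<tau> / 2 * (norm (p - w0))\<^sup>2)"] by simp
    finally have "A - inner a z + \<tau> / 2 * (norm (a - w0))\<^sup>2
        \<le> (1 - t) * A + t * B - inner p z + \<tau> / 2 * (norm (p - w0))\<^sup>2"
      by simp
    moreover define X where "X = inner (a - w0) (v - a)"
    moreover define Y where "Y = inner (v - a) z"
    moreover have "(norm (p - w0))\<^sup>2 = (norm (a - w0))\<^sup>2 + 2 * t * inner (a - w0) (v - a) + t\<^sup>2 * (norm (v - a))\<^sup>2"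
      unfolding p_def power2_norm_eq_inner by (simp add: inner_simps inner_commute power2_eq_square algebra_simps)
    moreover have "inner p z = inner a z + t * inner (v - a) z" by (simp add: p_def inner_simps)
    ultimately have "A - inner a z + \<tau> / 2 * (norm (a - w0))\<^sup>2
        \<le> (1 - t) * A + t * B - (inner a z + t * Y)
          + \<tau> / 2 * ((norm (a - w0))\<^sup>2 + 2 * t * X + t\<^sup>2 * (norm (v - a))\<^sup>2)"
      by simp
    then have "t * (A - B + Y - \<tau> * X - \<tau> / 2 * (norm (v - a))\<^sup>2 * t) \<le> 0"
      by (simp add: algebra_simps power2_eq_square)
    then have "A - B + inner (v - a) z - \<tau> * inner (a - w0) (v - a) - \<tau> / 2 * (norm (v - a))\<^sup>2 * t \<le> 0"
      using t(1) by (simp add: mult_le_0_iff X_def Y_def)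
    moreover have "inner (v - a) z - \<tau> * inner (a - w0) (v - a) = inner (v - a) u"
      by (simp add: u_def inner_simps inner_commute algebra_simps)
    ultimately show ?thesis by (simp add: B_def inner_diff_left)
  qed
  have "((\<lambda>t. \<tau> / 2 * (norm (v - a))\<^sup>2 * t) \<longlongrightarrow> \<tau> / 2 * (norm (v - a))\<^sup>2 * 0) (at_right (0::real))"
    by (intro tendsto_intros)
  moreover have "\<forall>\<^sub>F t in at_right (0::real). A - inner a u + g u \<le> \<tau> / 2 * (norm (v - a))\<^sup>2 * t"
    using le by (intro eventually_at_rightI[of 0 1]) auto
  ultimately have "A - inner a u + g u \<le> \<tau> / 2 * (norm (v - a))\<^sup>2 * 0"
    by (intro tendsto_lowerbound) auto
  then have "A \<le> inner a u - g u" by simp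
  moreover have "inner a s - g s \<le> A" for s using fenchel_conj_ge[of a s g] A by auto
  ultimately show ?thesis unfolding is_subgradient_def u_def[symmetric]
    by (smt (verit) inner_diff_right)
qed

text \<open>Moving from \<open>u\<close> by a unit along \<open>v\<close> raises \<open>g\<close> by
  at least \<open>norm v\<close>, while \<open>g\<close> is bounded on a ball with one unit to spare
  around \<open>S\<close>.\<close>

lemma subgradients_bounded:
  fixes g :: "'a::euclidean_space \<Rightarrow> real"
  assumes g: "continuous_on UNIV g" and S: "bounded S"
  obtains M where "\<And>u v. u \<in> S \<Longrightarrow> is_subgradient g u v \<Longrightarrow> norm v \<le> M"
proof -
  obtain R where R: "\<And>u. u \<in> S \<Longrightarrow> norm u \<le> R" using S by (auto simp: bounded_iff)
  have "compact (g ` cball 0 (R + 1))"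
    using g by (intro compact_continuous_image) (auto intro: continuous_on_subset)
  then obtain C where C: "\<And>u. norm u \<le> R + 1 \<Longrightarrow> \<bar>g u\<bar> \<le> C"
    by (force dest!: compact_imp_bounded simp: bounded_iff)
  have "norm v \<le> 2 * C" if u: "u \<in> S" and v: "is_subgradient g u v" for u v
  proof -
    define e where "e = sgn v"
    have e: "norm e \<le> 1" "inner v e = norm v"
      by (auto simp: e_def norm_sgn) (simp add: sgn_div_norm field_simps flip: power2_norm_eq_inner, simp add: power2_eq_square)
    have "norm (u + e) \<le> R + 1" using R[OF u] e norm_triangle_ineq[of u e] by linarith
    then have "\<bar>g (u + e)\<bar> \<le> C" "\<bar>g u\<bar> \<le> C" using C R[OF u] by force+
    moreover have "g u + norm v \<le> g (u + e)"
      using v[unfolded is_subgradient_def, rule_format, of "u + e"] e by simp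
    ultimately show ?thesis by linarith
  qed
  then show ?thesis using that by blast
qed

section \<open>Quadratic bounds from the gradient\<close>

lemma gradient_along_line:
  fixes f :: "'a::real_inner \<Rightarrow> real"
  assumes "\<And>u. (f has_derivative (\<lambda>v. inner (f' u) v)) (at u)"
  shows "((\<lambda>t. f (x + t *\<^sub>R d)) has_real_derivative inner (f' (x + t *\<^sub>R d)) d) (at t)"
proof -
  have "((\<lambda>t. x + t *\<^sub>R d) has_derivative (\<lambda>s. s *\<^sub>R d)) (at t)"
    by (auto intro!: derivative_eq_intros)
  from has_derivative_compose[OF this assms]
  show ?thesis by (simp add: has_field_derivative_def mult_commute_abs)
qed

text \<open>Along the segment, the difference \<open>k\<close> between \<open>f\<close> and its
  quadratic model has non-positive derivative, by Cauchy-Schwarz and the Lipschitz bound.\<close>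

lemma lipschitz_gradient_upper:
  fixes f :: "'a::real_inner \<Rightarrow> real"
  assumes der: "\<And>u. (f has_derivative (\<lambda>v. inner (f' u) v)) (at u)"
    and lip: "L-lipschitz_on UNIV f'"
  shows "f y \<le> f x + inner (f' x) (y - x) + L / 2 * (norm (y - x))\<^sup>2"
proof -
  define d where "d = y - x"
  define k where "k t = f (x + t *\<^sub>R d) - t * inner (f' x) d - L / 2 * t\<^sup>2 * (norm d)\<^sup>2" for t
  have "k 1 \<le> k 0"
  proof (rule DERIV_nonpos_imp_nonincreasing[where f = k])
    fix t :: real assume t: "0 \<le> t"
    have "(k has_real_derivative (inner (f' (x + t *\<^sub>R d)) d - inner (f' x) d - L * t * (norm d)\<^sup>2)) (at t)"
      unfolding k_def by (rule derivative_eq_intros gradient_along_line[OF der] refl | simp)+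
    moreover have "inner (f' (x + t *\<^sub>R d)) d - inner (f' x) d \<le> L * t * (norm d)\<^sup>2"
    proof -
      have "inner (f' (x + t *\<^sub>R d) - f' x) d \<le> norm (f' (x + t *\<^sub>R d) - f' x) * norm d"
        by (rule norm_cauchy_schwarz)
      also have "\<dots> \<le> (L * norm (t *\<^sub>R d)) * norm d"
        using lipschitz_onD[OF lip, of "x + t *\<^sub>R d" x]
        by (intro mult_right_mono) (auto simp: dist_norm)
      finally show ?thesis using t by (simp add: inner_diff_left power2_eq_square algebra_simps)
    qed
    ultimately show "\<exists>D. (k has_real_derivative D) (at t) \<and> D \<le> 0" by force
  qed simp
  then show ?thesis by (simp add: k_def d_def)
qed

lemma lipschitz_gradient_lower:
  fixes f :: "'a::real_inner \<Rightarrow> real"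
  assumes der: "\<And>u. (f has_derivative (\<lambda>v. inner (f' u) v)) (at u)"
    and lip: "L-lipschitz_on UNIV f'"
  shows "f x + inner (f' x) (y - x) - L / 2 * (norm (y - x))\<^sup>2 \<le> f y"
proof -
  have "((\<lambda>u. - f u) has_derivative (\<lambda>v. inner (- f' u) v)) (at u)" for u
    using has_derivative_minus[OF der[of u]] by simp
  moreover have "L-lipschitz_on UNIV (\<lambda>u. - f' u)" using lip by simp
  ultimately show ?thesis
    using lipschitz_gradient_upper[of "\<lambda>u. - f u" "\<lambda>u. - f' u" L y x] by simp
qed

text \<open>On the line through \<open>x\<close> and \<open>y\<close> the convexified function is a
  convex \<open>k\<close> of one variable. Its tangent at 0, evaluated at 1, is the claim: the inner
  products with \<open>x\<close> cancel and only \<open>(norm d)\<^sup>2\<close> survives.\<close>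

lemma weakly_convex_lower:
  fixes f :: "'a::real_inner \<Rightarrow> real"
  assumes der: "\<And>u. (f has_derivative (\<lambda>v. inner (f' u) v)) (at u)"
    and conv: "convex_on UNIV (\<lambda>u. f u + \<rho> / 2 * (norm u)\<^sup>2)"
  shows "f x + inner (f' x) (y - x) - \<rho> / 2 * (norm (y - x))\<^sup>2 \<le> f y"
proof -
  define d where "d = y - x"
  define k where "k t = f (x + t *\<^sub>R d) + \<rho> / 2 * (norm (x + t *\<^sub>R d))\<^sup>2" for t
  have k_eq: "k t = f (x + t *\<^sub>R d) + \<rho> / 2 * ((norm x)\<^sup>2 + 2 * t * inner x d + t\<^sup>2 * (norm d)\<^sup>2)" for t
    unfolding k_def power2_norm_eq_inner by (simp add: inner_simps inner_commute power2_eq_square algebra_simps)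
  have "convex_on UNIV k"
  proof (rule convex_onI)
    fix t a b :: real assume t: "0 < t" "t < 1"
    have "x + ((1 - t) * a + t * b) *\<^sub>R d = (1 - t) *\<^sub>R (x + a *\<^sub>R d) + t *\<^sub>R (x + b *\<^sub>R d)"
      by (simp add: algebra_simps)
    then show "k ((1 - t) *\<^sub>R a + t *\<^sub>R b) \<le> (1 - t) * k a + t * k b"
      using convex_onD[OF conv, of t "x + a *\<^sub>R d" "x + b *\<^sub>R d"] t by (simp add: k_def)
  qed simp
  moreover have "(k has_real_derivative (inner (f' x) d + \<rho> * inner x d)) (at 0 within UNIV)"
    unfolding k_eq
    by (rule derivative_eq_intros gradient_along_line[OF der, of x d 0, simplified] refl | simp)+
  ultimately have "k 1 - k 0 \<ge> (inner (f' x) d + \<rho> * inner x d) * (1 - 0)"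
    by (intro convex_on_imp_above_tangent[where A = UNIV]) auto
  then show ?thesis by (simp add: k_eq d_def algebra_simps)
qed

section \<open>Decay of sequences\<close>

lemma uniform_rate_if_eventual_rate:
  fixes X R :: "nat \<Rightarrow> real"
  assumes "\<And>n. n \<ge> N \<Longrightarrow> X n \<le> C * R n" "\<And>n. R n > 0"
  shows "\<exists>\<Gamma>>0. \<forall>n. X n \<le> \<Gamma> * R n"
proof -
  \<comment> \<open>The sum pays for the finitely many indices below \<open>N\<close>; the 1 keeps
    the constant positive even if \<open>C\<close> is 0.\<close>
  define \<Gamma> where "\<Gamma> = \<bar>C\<bar> + 1 + (\<Sum>k<N. \<bar>X k\<bar> / R k)"
  have s: "(\<Sum>k<N. \<bar>X k\<bar> / R k) \<ge> 0"
    using assms(2) by (intro sum_nonneg) (simp add: less_imp_le)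
  have "X n \<le> \<Gamma> * R n" for n
  proof (cases "n < N")
    case True
    then have "\<bar>X n\<bar> / R n \<le> (\<Sum>k<N. \<bar>X k\<bar> / R k)"
      using assms(2) by (intro member_le_sum) (auto simp: less_imp_le)
    then have "\<bar>X n\<bar> / R n \<le> \<Gamma>" by (simp add: \<Gamma>_def)
    then show ?thesis using assms(2)[of n] by (simp add: pos_divide_le_eq)
  next
    case False
    then have "X n \<le> C * R n" using assms(1) by simp
    also have "\<dots> \<le> \<Gamma> * R n"
      using s assms(2)[of n] by (intro mult_right_mono) (auto simp: \<Gamma>_def)
    finally show ?thesis .
  qed
  moreover have "\<Gamma> > 0" using s by (simp add: \<Gamma>_def)
  ultimately show ?thesis by blast
qed

text \<open>For recursions from \<open>n\<close> to \<open>n + 2\<close> valid from \<open>N\<close>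
  on: they first conclude something at \<open>N + 2\<close>, so all smaller indices are base
  cases.\<close>

lemma two_step_induct [case_names start step]:
  assumes "\<And>n. n < N + 2 \<Longrightarrow> P n" "\<And>n. n \<ge> N \<Longrightarrow> P n \<Longrightarrow> P (n + 2)"
  shows "P (n :: nat)"
proof (induction n rule: less_induct)
  case (less n)
  show ?case
  proof (cases "n < N + 2")
    case False
    then have "n - 2 < n" "n - 2 \<ge> N" "n = n - 2 + 2" by auto
    then show ?thesis using less assms(2)[of "n - 2"] by metis
  qed (rule assms(1))
qed

lemma geometric_decay:
  fixes r :: "nat \<Rightarrow> real"
  assumes dec: "decseq r" and nonneg: "\<And>n. 0 \<le> r n" and C: "C > 0"
    and rec: "\<And>n. n \<ge> N \<Longrightarrow> r (n + 2) \<le> C * (r n - r (n + 2))"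
  shows "\<exists>\<Gamma> \<zeta>. 0 < \<zeta> \<and> \<zeta> < 1 \<and> (\<forall>n. r n \<le> \<Gamma> * \<zeta> ^ n)"
proof -
  \<comment> \<open>Two steps contract by \<open>C / (1 + C)\<close>, so one step is charged its
    square root.\<close>
  define \<zeta> where "\<zeta> = sqrt (C / (1 + C))"
  have z: "0 < \<zeta>" "\<zeta> < 1" "\<zeta>\<^sup>2 = C / (1 + C)" using C by (auto simp: \<zeta>_def)
  define \<Gamma> where "\<Gamma> = r 0 / \<zeta> ^ (N + 1)"
  have G: "\<Gamma> \<ge> 0" using nonneg z by (simp add: \<Gamma>_def)
  have "r n \<le> \<Gamma> * \<zeta> ^ n" for n
  proof (induction n rule: two_step_induct[of N])
    case (start n)
    have "r n \<le> r 0" using dec by (simp add: decseq_def)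
    also have "\<dots> = \<Gamma> * \<zeta> ^ (N + 1)" using z by (simp add: \<Gamma>_def)
    also have "\<dots> \<le> \<Gamma> * \<zeta> ^ n"
      using z start G by (intro mult_left_mono power_decreasing) auto
    finally show ?case .
  next
    case (step n)
    have "r (n + 2) \<le> C / (1 + C) * r n" using rec[OF step(1)] C by (simp add: field_simps)
    also have "\<dots> \<le> C / (1 + C) * (\<Gamma> * \<zeta> ^ n)" using step C by (intro mult_left_mono) auto
    also have "\<dots> = \<Gamma> * \<zeta> ^ (n + 2)" unfolding power_add z(3) by simp
    finally show ?case .
  qed
  then show ?thesis using z by blast
qed

text \<open>The tangent inequality at \<open>a\<close> for the convex function
  \<open>t powr (-\<beta>)\<close>, obtained from \<open>ln t \<le> t - 1\<close> and
  \<open>1 + t \<le> exp t\<close>.\<close>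

lemma powr_minus_diff_le:
  fixes a b \<beta> :: real
  assumes "0 < a" "a \<le> b" "0 \<le> \<beta>"
  shows "a powr (-\<beta>) - b powr (-\<beta>) \<le> \<beta> * (b - a) * a powr (-\<beta> - 1)"
proof -
  have "1 - \<beta> * (b / a - 1) \<le> 1 - \<beta> * ln (b / a)"
    using assms ln_le_minus_one[of "b / a"] by (intro diff_left_mono mult_left_mono) auto
  also have "\<dots> \<le> (b / a) powr (-\<beta>)"
    using assms exp_ge_add_one_self[of "-\<beta> * ln (b / a)"] by (simp add: powr_def)
  finally have "a powr (-\<beta>) * (1 - \<beta> * (b / a - 1)) \<le> a powr (-\<beta>) * (b / a) powr (-\<beta>)"
    by (intro mult_left_mono) auto
  also have "a powr (-\<beta>) * (b / a) powr (-\<beta>) = b powr (-\<beta>)"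
    using assms by (simp flip: powr_mult)
  also have "a powr (-\<beta>) * (1 - \<beta> * (b / a - 1)) = a powr (-\<beta>) - \<beta> * (b - a) * (a powr (-\<beta>) / a)"
    using assms by (simp add: field_simps)
  also have "a powr (-\<beta>) / a = a powr (-\<beta> - 1)" using assms by (simp add: powr_diff)
  finally show ?thesis by simp
qed

text \<open>A violation at \<open>n + 2\<close> would make the drop forced by the recursion larger
  than the drop between the claimed bounds at \<open>n\<close> and \<open>n + 2\<close>.\<close>

lemma polynomial_decay:
  fixes r :: "nat \<Rightarrow> real"
  assumes dec: "decseq r" and nonneg: "\<And>n. 0 \<le> r n" and C: "C > 0" and \<beta>: "\<beta> > 0"
    and rec: "\<And>n. n \<ge> N \<Longrightarrow> r (n + 2) powr (1 + 1 / \<beta>) \<le> C * (r n - r (n + 2))"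
  shows "\<exists>\<Gamma>. \<forall>n. r n \<le> \<Gamma> * real (Suc n) powr (-\<beta>)"
proof -
  \<comment> \<open>The 2 is the index distance \<open>v - u\<close>, the 3 comes from
    \<open>v \<le> 3 * u\<close>. The first part of \<open>\<Gamma>\<close> ensures
    \<open>M \<le> \<Gamma> powr (1 / \<beta>)\<close>, the second covers the base indices.\<close>
  define M where "M = 2 * \<beta> * C * 3 powr (\<beta> + 1)"
  define \<Gamma> where "\<Gamma> = max (M powr \<beta>) (r 0 * real (N + 2) powr \<beta>)"
  have M: "M > 0" using C \<beta> by (simp add: M_def)
  have G: "\<Gamma> > 0" using M by (simp add: \<Gamma>_def less_max_iff_disj)
  have "M = (M powr \<beta>) powr (1 / \<beta>)" using M \<beta> by (simp add: powr_powr)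
  also have "\<dots> \<le> \<Gamma> powr (1 / \<beta>)" using \<beta> by (intro powr_mono2) (auto simp: \<Gamma>_def)
  finally have GM: "M \<le> \<Gamma> powr (1 / \<beta>)" .
  have "r n \<le> \<Gamma> * real (Suc n) powr (-\<beta>)" for n
  proof (induction n rule: two_step_induct[of N])
    case (start n)
    have "r n \<le> r 0" using dec by (simp add: decseq_def)
    also have "\<dots> = (r 0 * real (N + 2) powr \<beta>) * real (N + 2) powr (-\<beta>)"
      by (simp add: powr_minus)
    also have "\<dots> \<le> \<Gamma> * real (N + 2) powr (-\<beta>)" by (intro mult_right_mono) (auto simp: \<Gamma>_def)
    also have "\<dots> \<le> \<Gamma> * real (Suc n) powr (-\<beta>)"
      using start G \<beta> by (intro mult_left_mono powr_mono2') auto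
    finally show ?case .
  next
    case (step n)
    define u v where "u = real (Suc n)" and "v = real (Suc (n + 2))"
    have uv: "u > 0" "v = u + 2" "v \<le> 3 * u" by (auto simp: u_def v_def)
    have "r (n + 2) \<le> \<Gamma> * v powr (-\<beta>)"
    proof (rule ccontr)
      assume "\<not> ?thesis"
      then have gt: "\<Gamma> * v powr (-\<beta>) < r (n + 2)" by simp
      have "M * \<Gamma> * (3 * u) powr (-\<beta> - 1) \<le> \<Gamma> powr (1 / \<beta>) * \<Gamma> * v powr (-\<beta> - 1)"
        using GM M G uv \<beta> by (intro mult_mono powr_mono2') auto
      also have "\<dots> = (\<Gamma> * v powr (-\<beta>)) powr (1 + 1 / \<beta>)"
        using G uv \<beta> by (simp add: powr_mult powr_powr powr_add algebra_simps)
          (simp add: powr_diff powr_minus field_simps)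
      also have "\<dots> < r (n + 2) powr (1 + 1 / \<beta>)"
        using gt G uv \<beta> by (intro powr_less_mono2) (auto intro: add_pos_pos)
      also have "\<dots> \<le> C * (r n - r (n + 2))" by (rule rec[OF step(1)])
      also have "\<dots> \<le> C * (\<Gamma> * u powr (-\<beta>) - \<Gamma> * v powr (-\<beta>))"
        using step(2) gt C by (intro mult_left_mono diff_mono) (auto simp: u_def)
      also have "\<dots> = C * \<Gamma> * (u powr (-\<beta>) - v powr (-\<beta>))" by (simp add: algebra_simps)
      also have "\<dots> \<le> C * \<Gamma> * (\<beta> * (v - u) * u powr (-\<beta> - 1))"
        using uv \<beta> C G by (intro mult_left_mono powr_minus_diff_le) auto
      also have "\<dots> = M * \<Gamma> * (3 * u) powr (-\<beta> - 1)"
      proof -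
        have "3 powr (\<beta> + 1) * (3 * u) powr (-\<beta> - 1) = u powr (-\<beta> - 1)"
          using uv by (simp add: powr_mult powr_minus flip: minus_add_distrib mult.assoc)
            (simp add: powr_diff powr_minus powr_add)
        then show ?thesis using uv by (simp add: M_def algebra_simps)
      qed
      finally show False by simp
    qed
    then show ?case by (simp add: v_def)
  qed
  then show ?thesis by blast
qed

section \<open>Descent sequences under the KL inequality\<close>

text \<open>The tangent is taken at the interior point \<open>s\<close>, so \<open>t = 0\<close> is
  allowed although \<open>v\<close> need not be differentiable there.\<close>

lemma desing_tangent:
  assumes des: "desing \<eta> v v'" and s: "0 < s" "ereal s < \<eta>" and t: "0 \<le> t" "t \<le> s"
  shows "v' s * (s - t) \<le> v s - v t"
proof -
  let ?A = "{t. 0 \<le> t \<and> ereal t < \<eta>}"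
  have "convex ?A"
  proof (rule is_interval_convex)
    show "is_interval ?A"
      unfolding is_interval_1 by (auto intro: le_less_trans[of "ereal _" "ereal _" \<eta>])
  qed
  then have conn: "connected ?A" by (rule convex_connected)
  have "convex_on ?A (\<lambda>t. - v t)" using des by (simp add: desing_def concave_on_def)
  moreover have "s \<in> interior ?A"
  proof (rule interiorI)
    show "open {t. 0 < t \<and> ereal t < \<eta>}"
      by (intro open_Collect_conj open_Collect_less continuous_intros)
  qed (use s in auto)
  moreover have "t \<in> ?A" using s t by (auto intro: le_less_trans[of "ereal t" "ereal s"])
  moreover have "((\<lambda>t. - v t) has_field_derivative - v' s) (at s within ?A)"
    using des s by (auto simp: desing_def intro!: DERIV_minus intro: has_field_derivative_at_within)
  ultimately have "- v t - - v s \<ge> - v' s * (t - s)"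
    using convex_on_imp_above_tangent[of ?A "\<lambda>t. - v t" s t "- v' s"] conn by simp
  then show ?thesis by (simp add: algebra_simps)
qed

text \<open>The interface between the algorithm and the KL argument. \<open>\<delta>\<close> need
  not be the step length; it is any quantity whose square the decrease pays for. The subgradient
  bound starts at index 1, since the first subgradient may depend on arbitrary starting
  values.\<close>

locale descent_sequence =
  fixes \<phi> :: "'a::euclidean_space \<Rightarrow> ereal" and p s :: "nat \<Rightarrow> 'a"
    and E \<delta> :: "nat \<Rightarrow> real" and a b :: real
  assumes val: "\<And>n. \<phi> (p n) = ereal (E n)"
    and a_pos: "0 < a" and b_pos: "0 < b" and \<delta>_nonneg: "\<And>n. 0 \<le> \<delta> n"
    and decrease: "\<And>n. a * (\<delta> n)\<^sup>2 \<le> E n - E (Suc n)"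
    and subgrad: "\<And>n. s n \<in> frechet_subdiff \<phi> (p n)"
    and subgrad_bound: "\<And>n. norm (s (Suc n)) \<le> b * (\<delta> n + \<delta> (Suc n))"
    and step_bound: "\<And>n. norm (p (Suc n) - p n) \<le> b * (\<delta> n + \<delta> (Suc n))"
begin

lemma decseq_E: "decseq E"
proof (rule decseq_SucI)
  fix n
  have "0 \<le> a * (\<delta> n)\<^sup>2" using a_pos by simp
  then show "E (Suc n) \<le> E n" using decrease[of n] by linarith
qed

lemma \<delta>_le_sqrt:
  assumes "c \<le> E (Suc n)"
  shows "\<delta> n \<le> sqrt ((E n - c) / a)"
proof (rule real_le_rsqrt)
  show "(\<delta> n)\<^sup>2 \<le> (E n - c) / a"
    using decrease[of n] a_pos assms by (simp add: pos_le_divide_eq mult.commute)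
qed

lemma \<delta>_tendsto_if_bounded_below:
  assumes "\<And>n. c \<le> E n"
  shows "\<delta> \<longlonglongrightarrow> 0"
proof (rule tendsto_sandwich[OF _ _ tendsto_const])
  obtain l where l: "E \<longlonglongrightarrow> l" using decseq_convergent[OF decseq_E, of c] assms by metis
  have "(\<lambda>n. sqrt ((E n - E (Suc n)) / a)) \<longlonglongrightarrow> sqrt ((l - l) / a)"
    using a_pos by (intro tendsto_intros l LIMSEQ_Suc) auto
  then show "(\<lambda>n. sqrt ((E n - E (Suc n)) / a)) \<longlonglongrightarrow> 0" by simp
qed (auto simp: \<delta>_nonneg intro!: always_eventually \<delta>_le_sqrt)

end

text \<open>\<open>\<phi>\<close> need not be continuous, so \<open>val_ps\<close> is a genuine
  requirement: it makes \<open>E n - Es\<close> the gap that occurs in the KL inequality at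
  \<open>ps\<close>.\<close>

locale descent_cluster = descent_sequence +
  fixes ps and Es :: real and r :: "nat \<Rightarrow> nat"
  assumes r: "strict_mono r" and p_r: "(\<lambda>k. p (r k)) \<longlonglongrightarrow> ps" and E_r: "(\<lambda>k. E (r k)) \<longlonglongrightarrow> Es"
    and val_ps: "\<phi> ps = ereal Es"
begin

lemma E_ge: "Es \<le> E n"
proof (rule tendsto_upperbound[OF E_r])
  have "E (r k) \<le> E n" if "k \<ge> n" for k
    using decseq_E seq_suble[OF r, of k] that by (simp add: decseq_def)
  then show "\<forall>\<^sub>F k in sequentially. E (r k) \<le> E n" by (auto simp: eventually_sequentially)
qed simp

lemma E_tendsto: "E \<longlonglongrightarrow> Es"
proof -
  obtain l where l: "E \<longlonglongrightarrow> l" using decseq_convergent[OF decseq_E, of Es] E_ge by metis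
  from LIMSEQ_subseq_LIMSEQ[OF this r] have "l = Es"
    using E_r LIMSEQ_unique by (auto simp: comp_def)
  then show ?thesis using l by simp
qed

lemma gap_tendsto: "(\<lambda>n. E n - Es) \<longlonglongrightarrow> 0"
  using tendsto_diff[OF E_tendsto tendsto_const, of Es] by simp

lemma \<delta>_tendsto: "\<delta> \<longlonglongrightarrow> 0"
  using E_ge by (rule \<delta>_tendsto_if_bounded_below)

text \<open>The KL property is only granted on \<open>dom_subdiff \<phi>\<close>. As the
  subgradients \<open>s\<close> vanish and the values converge along the subsequence, 0 is a
  limiting subgradient at \<open>ps\<close>.\<close>

lemma cluster_mem_dom_subdiff: "ps \<in> dom_subdiff \<phi>"
proof -
  have s: "s \<longlonglongrightarrow> 0"
  proof (rule LIMSEQ_imp_Suc[of s], rule tendsto_norm_zero_cancel, rule tendsto_sandwich[OF _ _ tendsto_const])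
    have "(\<lambda>n. b * (\<delta> n + \<delta> (Suc n))) \<longlonglongrightarrow> b * (0 + 0)"
      by (intro tendsto_intros \<delta>_tendsto LIMSEQ_Suc)
    then show "(\<lambda>n. b * (\<delta> n + \<delta> (Suc n))) \<longlonglongrightarrow> 0" by simp
  qed (auto intro!: always_eventually subgrad_bound)
  have "0 \<in> limiting_subdiff \<phi> ps"
    unfolding limiting_subdiff_def
  proof (intro CollectI exI conjI allI)
    show "(\<lambda>k. p (r k)) \<longlonglongrightarrow> ps" by (rule p_r)
    show "(\<lambda>k. \<phi> (p (r k))) \<longlonglongrightarrow> \<phi> ps" using E_r by (simp add: val val_ps)
    show "(\<lambda>k. s (r k)) \<longlonglongrightarrow> 0" using LIMSEQ_subseq_LIMSEQ[OF s r] by (simp add: comp_def)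
  qed (rule subgrad)
  then show ?thesis by (auto simp: dom_subdiff_def)
qed

text \<open>The KL inequality says nothing where the gap is 0. Then monotonicity freezes
  \<open>E\<close>, the decrease makes \<open>\<delta>\<close> vanish, and the step bound stops the
  iterates, necessarily at the cluster point.\<close>

lemma stationary:
  assumes N: "E N = Es" and n: "n \<ge> N"
  shows "E n = Es" "\<delta> n = 0" "p n = ps"
proof -
  have E: "E m = Es" if "m \<ge> N" for m
    using decseq_E N that E_ge[of m] by (metis decseq_def order_antisym)
  have d: "\<delta> m = 0" if "m \<ge> N" for m
    using decrease[of m] E[OF that] E[of "Suc m"] that a_pos \<delta>_nonneg[of m] by (simp add: mult_le_0_iff)
  have p: "p m = p N" if "m \<ge> N" for m
    using that
  proof (induction m rule: dec_induct)
    case (step m)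
    then show ?case using step_bound[of m] d[of m] d[of "Suc m"] by simp
  qed simp
  have "(\<lambda>k. p (r k)) \<longlonglongrightarrow> p N"
  proof (rule tendsto_eventually, rule eventually_sequentiallyI)
    fix k assume "k \<ge> N"
    then show "p (r k) = p N" using seq_suble[OF r, of k] by (intro p) simp
  qed
  then have "p N = ps" using p_r LIMSEQ_unique by blast
  then show "E n = Es" "\<delta> n = 0" "p n = ps" using E[OF n] d[OF n] p[OF n] by simp_all
qed

lemma KL_inequality:
  assumes KL: "KL_ineq \<phi> ps \<eta> V v'" and V: "p (Suc n) \<in> V"
    and pos: "Es < E (Suc n)" and less: "ereal (E (Suc n) - Es) < \<eta>"
    and v': "0 < v' (E (Suc n) - Es)"
  shows "1 \<le> v' (E (Suc n) - Es) * (b * (\<delta> n + \<delta> (Suc n)))"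
proof -
  have "\<phi> (p (Suc n)) < \<phi> ps + \<eta>" using less by (cases \<eta>) (auto simp: val val_ps)
  then have "1 \<le> ereal (v' (E (Suc n) - Es)) * (INF t\<in>limiting_subdiff \<phi> (p (Suc n)). ereal (norm t))"
    using KL[unfolded KL_ineq_def, rule_format, OF V] pos by (auto simp: val val_ps)
  also have "\<dots> \<le> ereal (v' (E (Suc n) - Es)) * ereal (norm (s (Suc n)))"
    using v' by (intro ereal_mult_left_mono INF_lower limiting_subdiff_if_frechet subgrad) auto
  also have "\<dots> = ereal (v' (E (Suc n) - Es) * norm (s (Suc n)))" by simp
  finally have "1 \<le> v' (E (Suc n) - Es) * norm (s (Suc n))" by simp
  also have "\<dots> \<le> v' (E (Suc n) - Es) * (b * (\<delta> n + \<delta> (Suc n)))"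
    using v' by (intro mult_left_mono subgrad_bound) auto
  finally show ?thesis .
qed

text \<open>Concavity bounds the desingularised decrease below by \<open>v'\<close> times
  \<open>a * (\<delta> (Suc n))\<^sup>2\<close>, and the KL inequality bounds \<open>v'\<close>
  below by the reciprocal of \<open>b * (\<delta> n + \<delta> (Suc n))\<close>. The coefficient 3
  against 1 leaves a positive multiple of \<open>\<delta>\<close> when the estimates are
  summed.\<close>

lemma KL_step:
  assumes des: "desing \<eta> v v'" and KL: "KL_ineq \<phi> ps \<eta> V v'" and V: "p (Suc n) \<in> V"
    and pos: "Es < E (Suc n)" and less: "ereal (E (Suc n) - Es) < \<eta>"
  shows "3 * \<delta> (Suc n) \<le> 4 * b / a * (v (E (Suc n) - Es) - v (E (Suc (Suc n)) - Es)) + \<delta> n"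
proof -
  define D where "D = v (E (Suc n) - Es) - v (E (Suc (Suc n)) - Es)"
  define X where "X = b / a * D"
  define V' where "V' = v' (E (Suc n) - Es)"
  define S where "S = \<delta> n + \<delta> (Suc n)"
  have S: "S \<ge> 0" using \<delta>_nonneg by (simp add: S_def)
  have V': "V' > 0" using des pos less by (simp add: desing_def V'_def)
  have "V' * ((E (Suc n) - Es) - (E (Suc (Suc n)) - Es)) \<le> D"
    unfolding D_def V'_def using pos less E_ge decseq_E
    by (intro desing_tangent[OF des]) (auto simp: decseq_def)
  moreover have "V' * (a * (\<delta> (Suc n))\<^sup>2) \<le> V' * (E (Suc n) - E (Suc (Suc n)))"
    using V' by (intro mult_left_mono decrease) auto
  ultimately have D: "V' * (a * (\<delta> (Suc n))\<^sup>2) \<le> D" by simp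
  moreover have "0 \<le> V' * (a * (\<delta> (Suc n))\<^sup>2)" using V' a_pos by simp
  ultimately have D0: "D \<ge> 0" by linarith
  have "1 \<le> V' * (b * S)"
    using KL_inequality[OF KL V pos less] V' by (simp add: V'_def S_def)
  then have "1 * (a * (\<delta> (Suc n))\<^sup>2) \<le> V' * (b * S) * (a * (\<delta> (Suc n))\<^sup>2)"
    using a_pos by (intro mult_right_mono) auto
  also have "\<dots> = (V' * (a * (\<delta> (Suc n))\<^sup>2)) * (b * S)" by simp
  also have "\<dots> \<le> D * (b * S)" using D S b_pos by (intro mult_right_mono) auto
  finally have "(\<delta> (Suc n))\<^sup>2 \<le> b / a * D * S" using a_pos by (simp add: field_simps)
  also have "\<dots> = 4 * (b / a * D) * (S / 4)" by simp
  also have "\<dots> \<le> (b / a * D + S / 4)\<^sup>2"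
    using zero_le_power2[of "b / a * D - S / 4"] unfolding power2_sum power2_diff by linarith
  \<comment> \<open>the last bound is AM-GM, with weights that leave only a quarter of \<open>\<delta> n + \<delta> (Suc n)\<close> on the right\<close>
  finally have "(\<delta> (Suc n))\<^sup>2 \<le> (b / a * D + S / 4)\<^sup>2" .
  moreover have "0 \<le> b / a * D + S / 4" using D0 S a_pos b_pos by simp
  ultimately have "\<delta> (Suc n) \<le> b / a * D + S / 4" by (rule power2_le_imp_le)
  then have "3 * \<delta> (Suc n) \<le> 4 * X + \<delta> n" unfolding X_def[symmetric] S_def by argo
  then show ?thesis by (simp add: X_def D_def)
qed

lemma sum_\<delta>_le:
  assumes des: "desing \<eta> v v'" and KL: "KL_ineq \<phi> ps \<eta> V v'"
    and pos: "\<And>n. Es < E n" and less: "\<And>n. n \<ge> N \<Longrightarrow> ereal (E n - Es) < \<eta>"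
    and V: "\<And>k. k < j \<Longrightarrow> p (Suc N + k) \<in> V"
  shows "2 * (\<Sum>k<j. \<delta> (Suc N + k)) \<le> 4 * b / a * v (E (Suc N) - Es) + \<delta> N"
proof -
  \<comment> \<open>The term \<open>\<delta> (N + j)\<close> strengthens the induction: it pays for
    the same term on the right of \<open>KL_step\<close>.\<close>
  have "2 * (\<Sum>k<j. \<delta> (Suc N + k)) + \<delta> (N + j)
      \<le> 4 * b / a * (v (E (Suc N) - Es) - v (E (Suc N + j) - Es)) + \<delta> N"
    using V
  proof (induction j)
    case (Suc j)
    have "3 * \<delta> (Suc (N + j)) \<le> 4 * b / a * (v (E (Suc (N + j)) - Es) - v (E (Suc (Suc (N + j))) - Es)) + \<delta> (N + j)"
      using Suc.prems[of j] pos less by (intro KL_step[OF des KL]) auto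
    then show ?case using Suc by (simp add: algebra_simps)
  qed simp
  moreover have "4 * b / a * v (E (Suc N + j) - Es) \<ge> 0"
    using des less[of "Suc N + j"] E_ge[of "Suc N + j"] a_pos b_pos by (simp add: desing_def)
  ultimately show ?thesis using \<delta>_nonneg[of "N + j"] by (simp add: right_diff_distrib)
qed

text \<open>The endpoint \<open>p (Suc N + j)\<close> is not assumed to lie in \<open>V\<close>, so
  the bound can be used to prove that it does.\<close>

lemma path_le:
  assumes des: "desing \<eta> v v'" and KL: "KL_ineq \<phi> ps \<eta> V v'"
    and pos: "\<And>n. Es < E n" and less: "\<And>n. n \<ge> N \<Longrightarrow> ereal (E n - Es) < \<eta>"
    and V: "\<And>k. k < j \<Longrightarrow> p (Suc N + k) \<in> V"
  shows "norm (p (Suc N + j) - p (Suc N)) \<le> b * (4 * b / a * v (E (Suc N) - Es) + \<delta> N + \<delta> (Suc N + j))"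
proof -
  \<comment> \<open>A step is bounded by two consecutive values of \<open>\<delta>\<close>, so the
    sum counts each value at most twice.\<close>
  have "norm (p (Suc N + j) - p (Suc N)) \<le> b * (2 * (\<Sum>k<j. \<delta> (Suc N + k)) + \<delta> (Suc N + j))"
  proof (induction j)
    case 0 show ?case using b_pos \<delta>_nonneg by simp
  next
    case (Suc j)
    have "norm (p (Suc N + Suc j) - p (Suc N))
        \<le> norm (p (Suc (Suc N + j)) - p (Suc N + j)) + norm (p (Suc N + j) - p (Suc N))"
      by (rule order_trans[OF _ norm_triangle_ineq]) simp
    also have "\<dots> \<le> b * (\<delta> (Suc N + j) + \<delta> (Suc (Suc N + j)))
        + b * (2 * (\<Sum>k<j. \<delta> (Suc N + k)) + \<delta> (Suc N + j))"
      by (intro add_mono step_bound Suc.IH)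
    finally show ?case by (simp add: algebra_simps)
  qed
  also have "\<dots> \<le> b * (4 * b / a * v (E (Suc N) - Es) + \<delta> N + \<delta> (Suc N + j))"
    using sum_\<delta>_le[OF des KL pos less V] b_pos by (intro mult_left_mono add_right_mono) auto
  finally show ?thesis by simp
qed

lemma desing_gap_tendsto:
  assumes des: "desing \<eta> v v'" and \<eta>: "\<eta> > 0"
  shows "\<forall>\<^sub>F n in sequentially. ereal (E n - Es) < \<eta>" "(\<lambda>n. v (E n - Es)) \<longlonglongrightarrow> 0"
proof -
  have "(\<lambda>n. ereal (E n - Es)) \<longlonglongrightarrow> 0" using gap_tendsto by (simp add: zero_ereal_def)
  then show ev: "\<forall>\<^sub>F n in sequentially. ereal (E n - Es) < \<eta>" using \<eta> by (rule order_tendstoD)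
  have "(\<lambda>n. v (E n - Es)) \<longlonglongrightarrow> v 0"
  proof (rule continuous_on_tendsto_compose[OF _ gap_tendsto])
    show "continuous_on {t. 0 \<le> t \<and> ereal t < \<eta>} v" using des by (simp add: desing_def)
    show "\<forall>\<^sub>F n in sequentially. E n - Es \<in> {t. 0 \<le> t \<and> ereal t < \<eta>}"
      using ev by (auto elim!: eventually_mono simp: E_ge)
  qed (use \<eta> in \<open>simp add: zero_ereal_def\<close>)
  then show "(\<lambda>n. v (E n - Es)) \<longlonglongrightarrow> 0" using des by (simp add: desing_def)
qed

lemma summable_\<delta>:
  assumes "KL_at \<phi> ps"
  shows "summable \<delta>"
proof (cases "\<exists>N. E N = Es")
  case True
  then obtain N where N: "E N = Es" by blast
  have "\<delta> n = 0" if "n \<notin> {..<N}" for n using stationary(2)[OF N] that by simp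
  then show ?thesis by (intro summable_finite[of "{..<N}"]) auto
next
  case False
  then have pos: "Es < E n" for n using E_ge[of n] by (metis order_le_less)
  obtain \<eta> V v v' where \<eta>: "\<eta> > 0" and V: "open V" "ps \<in> V"
    and des: "desing \<eta> v v'" and KL: "KL_ineq \<phi> ps \<eta> V v'"
    using assms unfolding KL_at_def by blast
  obtain \<epsilon> where \<epsilon>: "\<epsilon> > 0" "ball ps \<epsilon> \<subseteq> V" using V openE by blast
  define K where "K = 4 * b / a"
  have K: "K > 0" using a_pos b_pos by (simp add: K_def)
  \<comment> \<open>\<open>path_le\<close> needs room for \<open>K + 2\<close> multiples of
    \<open>e\<close>; one more makes the estimate \<open>e2\<close> strict.\<close>
  define K3 where "K3 = K + 3"
  define e where "e = \<epsilon> / 2 / b / K3"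
  have "K3 > 0" using K by (simp add: K3_def)
  then have e: "e > 0" and e_eq: "b * K3 * e = \<epsilon> / 2" using \<epsilon> b_pos by (simp_all add: e_def)
  have "b * e > 0" using e b_pos by simp
  with e_eq have e2: "b * (K * e + e + e) < \<epsilon> / 2" by (simp add: K3_def algebra_simps)
  have "\<forall>\<^sub>F n in sequentially. ereal (E n - Es) < \<eta> \<and> v (E n - Es) < e \<and> \<delta> n < e"
    using desing_gap_tendsto(1)[OF des \<eta>] order_tendstoD(2)[OF desing_gap_tendsto(2)[OF des \<eta>] e]
      order_tendstoD(2)[OF \<delta>_tendsto e]
    by eventually_elim simp
  then obtain M where M: "\<And>n. n \<ge> M \<Longrightarrow> ereal (E n - Es) < \<eta> \<and> v (E n - Es) < e \<and> \<delta> n < e"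
    unfolding eventually_sequentially by blast
  have "\<forall>\<^sub>F k in sequentially. dist (p (r k)) ps < \<epsilon> / 2" using p_r \<epsilon> by (intro tendstoD) auto
  then obtain k0 where k0: "\<And>k. k \<ge> k0 \<Longrightarrow> dist (p (r k)) ps < \<epsilon> / 2"
    unfolding eventually_sequentially by blast
  \<comment> \<open>The trap starts at an index of the subsequence, where the iterate is close to
    \<open>ps\<close>; the bounds from \<open>M\<close> must already hold one index earlier.\<close>
  define N where "N = r (max k0 (Suc M)) - 1"
  have "r (max k0 (Suc M)) \<ge> Suc M" using seq_suble[OF r, of "max k0 (Suc M)"] by simp
  then have N: "N \<ge> M" "Suc N = r (max k0 (Suc M))" by (auto simp: N_def)
  have near: "norm (p (Suc N) - ps) < \<epsilon> / 2" unfolding N(2) using k0 by (simp add: dist_norm)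
  have gap_less: "ereal (E n - Es) < \<eta>" if "n \<ge> N" for n using M N that by simp
  \<comment> \<open>If the earlier iterates lie in \<open>V\<close>, the next one is within half the
    radius of \<open>p (Suc N)\<close>, which is itself within half the radius of
    \<open>ps\<close>.\<close>
  have inV: "p (Suc N + j) \<in> V" for j
  proof (induction j rule: less_induct)
    case (less j)
    have "norm (p (Suc N + j) - p (Suc N)) \<le> b * (K * v (E (Suc N) - Es) + \<delta> N + \<delta> (Suc N + j))"
      unfolding K_def by (rule path_le[OF des KL pos gap_less less])
    also have "\<dots> \<le> b * (K * e + e + e)"
      using b_pos K M[of N] M[of "Suc N"] M[of "Suc N + j"] N
      by (intro mult_left_mono add_mono) auto
    also note e2
    finally have "norm (p (Suc N + j) - ps) < \<epsilon>"
      using near norm_triangle_ineq[of "p (Suc N + j) - p (Suc N)" "p (Suc N) - ps"] by simp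
    then show ?case using \<epsilon>(2) by (auto simp: dist_norm norm_minus_commute)
  qed
  have "(\<Sum>k<j. \<delta> (Suc N + k)) \<le> (K * v (E (Suc N) - Es) + \<delta> N) / 2" for j
  proof -
    have "2 * (\<Sum>k<j. \<delta> (Suc N + k)) \<le> K * v (E (Suc N) - Es) + \<delta> N"
      unfolding K_def by (rule sum_\<delta>_le[OF des KL pos gap_less inV])
    then show ?thesis by simp
  qed
  then have "summable (\<lambda>k. \<delta> (Suc N + k))"
    by (intro summableI_nonneg_bounded \<delta>_nonneg)
  then show ?thesis using summable_iff_shift[of \<delta> "Suc N"] by (simp add: add.commute)
qed

lemma KL_convergence:
  assumes "KL_at \<phi> ps"
  shows "summable (\<lambda>n. norm (p (Suc n) - p n))" "p \<longlonglongrightarrow> ps"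
proof -
  have "summable (\<lambda>n. b * (\<delta> n + \<delta> (Suc n)))"
    using summable_\<delta>[OF assms] by (intro summable_mult summable_add) (auto simp: summable_Suc_iff)
  then show sum: "summable (\<lambda>n. norm (p (Suc n) - p n))"
    by (rule summable_comparison_test'[where N = 0]) (use step_bound in auto)
  then have "(\<lambda>n. \<Sum>k<n. p (Suc k) - p k) \<longlonglongrightarrow> (\<Sum>k. p (Suc k) - p k)"
    by (rule summable_LIMSEQ[OF summable_norm_cancel])
  then have "(\<lambda>n. (p n - p 0) + p 0) \<longlonglongrightarrow> (\<Sum>k. p (Suc k) - p k) + p 0"
    unfolding sum_lessThan_telescope by (intro tendsto_intros)
  then have "p \<longlonglongrightarrow> (\<Sum>k. p (Suc k) - p k) + p 0" by simp
  moreover from LIMSEQ_subseq_LIMSEQ[OF this r] have "(\<Sum>k. p (Suc k) - p k) + p 0 = ps"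
    using p_r LIMSEQ_unique by (auto simp: comp_def)
  ultimately show "p \<longlonglongrightarrow> ps" by simp
qed

end

section \<open>Convergence rates from a KL exponent\<close>

definition KL_exponent_at :: "('a::real_inner \<Rightarrow> ereal) \<Rightarrow> real \<Rightarrow> 'a \<Rightarrow> bool" where
  "KL_exponent_at \<phi> \<theta> xbar \<longleftrightarrow> (\<exists>\<eta> V c. c > 0 \<and> \<eta> > 0 \<and> open V \<and> xbar \<in> V
        \<and> desing \<eta> (\<lambda>t. c * t powr (1 - \<theta>)) (\<lambda>t. c * (1 - \<theta>) * t powr (- \<theta>))
        \<and> KL_ineq \<phi> xbar \<eta> V (\<lambda>t. c * (1 - \<theta>) * t powr (- \<theta>)))"

context descent_cluster
begin

lemma gap_nonneg: "0 \<le> E n - Es"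
  using E_ge by simp

lemma decseq_gap: "decseq (\<lambda>n. E n - Es)"
  using decseq_E by (simp add: decseq_def)

text \<open>The first bound is the KL inequality solved for the power of the gap; the second is
  \<open>path_le\<close> with its endpoint sent to the limit.\<close>

lemma exponent_bounds:
  assumes lim: "p \<longlonglongrightarrow> ps" and \<theta>: "\<theta> < 1" and KL: "KL_exponent_at \<phi> \<theta> ps"
  obtains C N where "C > 0"
    and "\<And>n. n \<ge> N \<Longrightarrow> (E (Suc n) - Es) powr \<theta> \<le> C * (\<delta> n + \<delta> (Suc n))"
    and "\<And>n. n \<ge> N \<Longrightarrow> norm (p (Suc n) - ps) \<le> C * ((E (Suc n) - Es) powr (1 - \<theta>) + \<delta> n)"
proof -
  obtain \<eta> V c where c: "c > 0" and \<eta>: "\<eta> > 0" and V: "open V" "ps \<in> V"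
    and des: "desing \<eta> (\<lambda>t. c * t powr (1 - \<theta>)) (\<lambda>t. c * (1 - \<theta>) * t powr (- \<theta>))"
    and ineq: "KL_ineq \<phi> ps \<eta> V (\<lambda>t. c * (1 - \<theta>) * t powr (- \<theta>))"
    using KL unfolding KL_exponent_at_def by blast
  have "\<forall>\<^sub>F n in sequentially. ereal (E n - Es) < \<eta> \<and> p n \<in> V"
    using desing_gap_tendsto(1)[OF des \<eta>] topological_tendstoD[OF lim V] by eventually_elim simp
  then obtain M where M: "\<And>n. n \<ge> M \<Longrightarrow> ereal (E n - Es) < \<eta> \<and> p n \<in> V"
    unfolding eventually_sequentially by blast
  \<comment> \<open>\<open>path_le\<close> needs every gap positive, so either no gap ever vanishes
    or \<open>N\<close> is taken so late that the gap is already 0 there.\<close>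
  obtain N where N: "N \<ge> M" "(\<forall>n. Es < E n) \<or> E N = Es"
  proof (cases "\<exists>m. E m = Es")
    case True
    then obtain m where "E m = Es" by blast
    then have "E (max m M) = Es" by (rule stationary) simp
    then show ?thesis using that[of "max m M"] by simp
  next
    case False
    then have "Es < E n" for n using E_ge[of n] by (metis order_le_less)
    then show ?thesis using that[of M] by simp
  qed
  define C where "C = max (c * (1 - \<theta>) * b) (max (b * (4 * b / a) * c) b)"
  have C: "C > 0" "c * (1 - \<theta>) * b \<le> C" "b * (4 * b / a) * c \<le> C" "b \<le> C"
    using b_pos by (auto simp: C_def)
  have "(E (Suc n) - Es) powr \<theta> \<le> C * (\<delta> n + \<delta> (Suc n)) \<and>
        norm (p (Suc n) - ps) \<le> C * ((E (Suc n) - Es) powr (1 - \<theta>) + \<delta> n)" if n: "n \<ge> N" for n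
  proof (cases "E N = Es")
    case True
    \<comment> \<open>\<open>0 powr \<theta>\<close> is 0 even for \<open>\<theta> = 0\<close>, so
      both bounds are trivial once the gap vanishes.\<close>
    then show ?thesis using stationary[OF True, of "Suc n"] n C \<delta>_nonneg by simp
  next
    case False
    then have pos: "Es < E n" for n using N(2) by blast
    let ?r = "E (Suc n) - Es"
    have "1 \<le> c * (1 - \<theta>) * ?r powr (- \<theta>) * (b * (\<delta> n + \<delta> (Suc n)))"
      using M[of "Suc n"] N(1) n pos[of "Suc n"] c \<theta> by (intro KL_inequality[OF ineq]) auto
    then have "?r powr \<theta> * 1 \<le> ?r powr \<theta> * (c * (1 - \<theta>) * ?r powr (- \<theta>) * (b * (\<delta> n + \<delta> (Suc n))))"
      by (intro mult_left_mono) auto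
    also have "\<dots> = (?r powr \<theta> * ?r powr (- \<theta>)) * (c * (1 - \<theta>) * b * (\<delta> n + \<delta> (Suc n)))"
      by (simp only: mult_ac)
    also have "?r powr \<theta> * ?r powr (- \<theta>) = 1" using pos[of "Suc n"] by (simp flip: powr_add)
    also have "1 * (c * (1 - \<theta>) * b * (\<delta> n + \<delta> (Suc n))) \<le> C * (\<delta> n + \<delta> (Suc n))"
      unfolding mult_1 using C(2) \<delta>_nonneg by (intro mult_right_mono) auto
    finally have 1: "?r powr \<theta> \<le> C * (\<delta> n + \<delta> (Suc n))" by simp
    have gap_less: "ereal (E m - Es) < \<eta>" if "m \<ge> n" for m using M N(1) n that by simp
    have inV: "p (Suc n + k) \<in> V" for k using M N(1) n by simp
    have "norm (p (Suc n + j) - p (Suc n)) \<le> b * (4 * b / a * (c * ?r powr (1 - \<theta>)) + \<delta> n + \<delta> (Suc n + j))" for j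
      by (rule path_le[OF des ineq pos gap_less inV])
    moreover have "(\<lambda>j. norm (p (Suc n + j) - p (Suc n))) \<longlonglongrightarrow> norm (ps - p (Suc n))"
      using LIMSEQ_ignore_initial_segment[OF lim, of "Suc n"] by (intro tendsto_intros) (simp add: add.commute)
    moreover have "(\<lambda>j. b * (4 * b / a * (c * ?r powr (1 - \<theta>)) + \<delta> n + \<delta> (Suc n + j)))
        \<longlonglongrightarrow> b * (4 * b / a * (c * ?r powr (1 - \<theta>)) + \<delta> n + 0)"
      using LIMSEQ_ignore_initial_segment[OF \<delta>_tendsto, of "Suc n"]
      by (intro tendsto_add tendsto_mult tendsto_const) (simp add: add.commute)
    ultimately have "norm (ps - p (Suc n)) \<le> b * (4 * b / a * (c * ?r powr (1 - \<theta>)) + \<delta> n + 0)"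
      by (intro LIMSEQ_le) auto
    also have "\<dots> = b * (4 * b / a) * c * ?r powr (1 - \<theta>) + b * \<delta> n" by (simp add: algebra_simps)
    also have "\<dots> \<le> C * ?r powr (1 - \<theta>) + C * \<delta> n"
      using C \<delta>_nonneg by (intro add_mono mult_right_mono) auto
    finally have "norm (p (Suc n) - ps) \<le> C * (?r powr (1 - \<theta>) + \<delta> n)"
      by (simp add: norm_minus_commute distrib_left)
    with 1 show ?thesis by blast
  qed
  then show ?thesis using that C(1) by blast
qed

text \<open>\<open>t powr 0\<close> is 1 for \<open>t \<noteq> 0\<close> and 0 for
  \<open>t = 0\<close>, so gaps that never vanish would keep 1 below a null sequence.\<close>

lemma finite_convergence:
  assumes "p \<longlonglongrightarrow> ps" "KL_exponent_at \<phi> 0 ps"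
  shows "\<exists>N. \<forall>n\<ge>N. p n = ps"
proof -
  obtain C N where C: "C > 0"
    and le: "\<And>n. n \<ge> N \<Longrightarrow> (E (Suc n) - Es) powr 0 \<le> C * (\<delta> n + \<delta> (Suc n))"
    using exponent_bounds[OF assms(1) zero_less_one assms(2)] by metis
  have "(\<lambda>n. C * (\<delta> n + \<delta> (Suc n))) \<longlonglongrightarrow> C * (0 + 0)"
    by (intro tendsto_intros \<delta>_tendsto LIMSEQ_Suc)
  then have "\<forall>\<^sub>F n in sequentially. C * (\<delta> n + \<delta> (Suc n)) < 1" by (rule order_tendstoD) simp
  then obtain M where "\<And>n. n \<ge> M \<Longrightarrow> C * (\<delta> n + \<delta> (Suc n)) < 1"
    unfolding eventually_sequentially by blast
  then have "(E (Suc (max N M)) - Es) powr 0 < 1" using le[of "max N M"] by (meson le_less_trans max.cobounded1 max.cobounded2)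
  then have "E (Suc (max N M)) = Es" by (auto split: if_splits)
  from stationary(3)[OF this] show ?thesis by blast
qed

text \<open>Squaring the KL bound produces two consecutive squares of \<open>\<delta>\<close>, and
  the decreases that pay for them telescope over two indices. In the distance bound,
  \<open>\<delta> n\<close> is at most a multiple of the square root of the gap; for gaps below 1
  the smaller of the exponents \<open>1 / 2\<close> and \<open>1 - \<theta>\<close> serves for both
  terms.\<close>

lemma exponent_recursion:
  assumes lim: "p \<longlonglongrightarrow> ps" and \<theta>: "0 < \<theta>" "\<theta> < 1" and KL: "KL_exponent_at \<phi> \<theta> ps"
  obtains C N where "C > 0" and "\<And>n. n \<ge> N \<Longrightarrow> E n - Es \<le> 1"
    and "\<And>n. n \<ge> N \<Longrightarrow> (E (n + 2) - Es) powr (2 * \<theta>) \<le> C * ((E n - Es) - (E (n + 2) - Es))"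
    and "\<And>n. n \<ge> N \<Longrightarrow> norm (p (Suc n) - ps) \<le> C * (E n - Es) powr min (1 / 2) (1 - \<theta>)"
proof -
  obtain C N where C: "C > 0"
    and pow: "\<And>n. n \<ge> N \<Longrightarrow> (E (Suc n) - Es) powr \<theta> \<le> C * (\<delta> n + \<delta> (Suc n))"
    and dist: "\<And>n. n \<ge> N \<Longrightarrow> norm (p (Suc n) - ps) \<le> C * ((E (Suc n) - Es) powr (1 - \<theta>) + \<delta> n)"
    using exponent_bounds[OF lim \<theta>(2) KL] by blast
  have "\<forall>\<^sub>F n in sequentially. E n - Es < 1" using gap_tendsto by (rule order_tendstoD) simp
  then obtain M where M: "\<And>n. n \<ge> M \<Longrightarrow> E n - Es < 1"
    unfolding eventually_sequentially by blast
  define C' where "C' = max (2 * C\<^sup>2 / a) (C * (1 + sqrt (1 / a)))"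
  have C': "C' > 0" using C a_pos by (simp add: C'_def less_max_iff_disj)
  have "(E (n + 2) - Es) powr (2 * \<theta>) \<le> C' * ((E n - Es) - (E (n + 2) - Es))" if "n \<ge> N" for n
  proof -
    have "(E (n + 2) - Es) powr (2 * \<theta>) \<le> (E (Suc n) - Es) powr (2 * \<theta>)"
      using \<theta> E_ge decseq_E by (intro powr_mono2) (auto simp: decseq_def)
    also have "\<dots> = ((E (Suc n) - Es) powr \<theta>)\<^sup>2"
      by (simp add: power2_eq_square flip: powr_add)
    also have "\<dots> \<le> (C * (\<delta> n + \<delta> (Suc n)))\<^sup>2" using pow[OF that] by (intro power_mono) auto
    also have "\<dots> \<le> C\<^sup>2 * (2 * ((\<delta> n)\<^sup>2 + (\<delta> (Suc n))\<^sup>2))"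
      using zero_le_power2[of "\<delta> n - \<delta> (Suc n)"]
      by (auto simp: power_mult_distrib power2_sum power2_diff intro!: mult_left_mono)
    also have "\<dots> = 2 * C\<^sup>2 / a * (a * (\<delta> n)\<^sup>2 + a * (\<delta> (Suc n))\<^sup>2)"
      using a_pos by (simp add: field_simps)
    also have "\<dots> \<le> 2 * C\<^sup>2 / a * ((E n - E (Suc n)) + (E (Suc n) - E (Suc (Suc n))))"
      using a_pos by (intro mult_left_mono add_mono decrease) auto
    also have "\<dots> = 2 * C\<^sup>2 / a * ((E n - Es) - (E (n + 2) - Es))" by simp
    also have "\<dots> \<le> C' * ((E n - Es) - (E (n + 2) - Es))"
      using decseqD[OF decseq_E, of n "n + 2"] by (intro mult_right_mono) (auto simp: C'_def)
    finally show ?thesis .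
  qed
  moreover have "norm (p (Suc n) - ps) \<le> C' * (E n - Es) powr min (1 / 2) (1 - \<theta>)" if n: "n \<ge> max N M" for n
  proof -
    let ?R = "(E n - Es) powr min (1 / 2) (1 - \<theta>)"
    have "(E (Suc n) - Es) powr (1 - \<theta>) \<le> (E n - Es) powr (1 - \<theta>)"
      using \<theta> E_ge decseq_E by (intro powr_mono2) (auto simp: decseq_def)
    also have "\<dots> \<le> ?R" using M[of n] n gap_nonneg[of n] \<theta> by (intro powr_mono') auto
    finally have 1: "(E (Suc n) - Es) powr (1 - \<theta>) \<le> ?R" .
    have "\<delta> n \<le> sqrt ((E n - Es) / a)" by (intro \<delta>_le_sqrt E_ge)
    also have "\<dots> = sqrt (1 / a) * (E n - Es) powr (1 / 2)"
      using gap_nonneg[of n] by (simp add: powr_half_sqrt real_sqrt_divide)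
    also have "\<dots> \<le> sqrt (1 / a) * ?R"
      using M[of n] n gap_nonneg[of n] a_pos
      by (intro mult_left_mono powr_mono' min.cobounded1) auto
    finally have "norm (p (Suc n) - ps) \<le> C * (?R + sqrt (1 / a) * ?R)"
      using dist[of n] n 1 C by (smt (verit) max.bounded_iff mult_left_mono)
    also have "\<dots> = C * (1 + sqrt (1 / a)) * ?R" by (simp add: algebra_simps)
    also have "\<dots> \<le> C' * ?R" by (intro mult_right_mono) (auto simp: C'_def)
    finally show ?thesis .
  qed
  ultimately show ?thesis using that[of C' "max N M"] C' M by (auto simp: less_imp_le)
qed

lemma geometric_rate:
  assumes lim: "p \<longlonglongrightarrow> ps" and \<theta>: "0 < \<theta>" "\<theta> \<le> 1 / 2" and KL: "KL_exponent_at \<phi> \<theta> ps"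
  shows "\<exists>\<Gamma>>0. \<exists>\<zeta>. 0 < \<zeta> \<and> \<zeta> < 1 \<and> (\<forall>n. norm (p n - ps) \<le> \<Gamma> * \<zeta> ^ n \<and> E n - Es \<le> \<Gamma> * \<zeta> ^ n)"
proof -
  obtain C N where C: "C > 0" and le1: "\<And>n. n \<ge> N \<Longrightarrow> E n - Es \<le> 1"
    and rec: "\<And>n. n \<ge> N \<Longrightarrow> (E (n + 2) - Es) powr (2 * \<theta>) \<le> C * ((E n - Es) - (E (n + 2) - Es))"
    and dist: "\<And>n. n \<ge> N \<Longrightarrow> norm (p (Suc n) - ps) \<le> C * (E n - Es) powr min (1 / 2) (1 - \<theta>)"
    using exponent_recursion[OF lim \<theta>(1) _ KL] \<theta>(2) by auto
  have "E (n + 2) - Es \<le> C * ((E n - Es) - (E (n + 2) - Es))" if "n \<ge> N" for n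
  proof -
    \<comment> \<open>For gaps up to 1 and \<open>2 * \<theta> \<le> 1\<close> the power dominates
      the gap itself, which makes the recursion linear.\<close>
    have "(E (n + 2) - Es) powr 1 \<le> (E (n + 2) - Es) powr (2 * \<theta>)"
      using \<theta> le1[of "n + 2"] that gap_nonneg[of "n + 2"] by (intro powr_mono') auto
    then show ?thesis using rec[OF that] gap_nonneg[of "n + 2"] by simp
  qed
  then obtain \<Gamma> \<zeta> where \<zeta>: "0 < \<zeta>" "\<zeta> < 1" and gap: "\<And>n. E n - Es \<le> \<Gamma> * \<zeta> ^ n"
    using geometric_decay[OF decseq_gap gap_nonneg C, of N] by blast
  \<comment> \<open>The distance is controlled by the square root of the gap, so its rate is
    \<open>sqrt \<zeta>\<close>; being larger than \<open>\<zeta>\<close>, it also serves for the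
    gap.\<close>
  define q where "q = sqrt \<zeta>"
  have q: "0 < q" "q < 1" "q\<^sup>2 = \<zeta>" using \<zeta> by (auto simp: q_def)
  have "\<zeta> \<le> q" using q by (metis less_imp_le mult_left_le_one_le power2_eq_square)
  have \<Gamma>: "\<Gamma> \<ge> 0" using gap[of 0] gap_nonneg[of 0] by simp
  have "norm (p n - ps) \<le> (C * sqrt \<Gamma> / q) * q ^ n" if n: "n \<ge> Suc N" for n
  proof -
    obtain m where m: "n = Suc m" "m \<ge> N" using n by (cases n) auto
    have "norm (p (Suc m) - ps) \<le> C * sqrt (E m - Es)"
      using dist[OF m(2)] gap_nonneg[of m] \<theta> by (simp add: powr_half_sqrt min_def)
    also have "\<dots> \<le> C * sqrt (\<Gamma> * \<zeta> ^ m)" using C gap[of m] by (intro mult_left_mono) auto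
    also have "\<dots> = (C * sqrt \<Gamma> / q) * q ^ n"
      using q \<zeta> by (simp add: m q_def real_sqrt_mult real_sqrt_power)
    finally show ?thesis by (simp add: m)
  qed
  then have "\<exists>\<Gamma>>0. \<forall>n. norm (p n - ps) \<le> \<Gamma> * q ^ n"
    by (rule uniform_rate_if_eventual_rate) (use q in auto)
  then obtain \<Gamma>1 where G1: "\<Gamma>1 > 0" "\<And>n. norm (p n - ps) \<le> \<Gamma>1 * q ^ n" by blast
  have pow: "0 \<le> q ^ n" "\<zeta> ^ n \<le> q ^ n" for n
    using q \<open>\<zeta> \<le> q\<close> \<zeta> by (auto intro: power_mono)
  have "norm (p n - ps) \<le> (\<Gamma>1 + \<Gamma>) * q ^ n \<and> E n - Es \<le> (\<Gamma>1 + \<Gamma>) * q ^ n" for n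
  proof -
    have "\<Gamma> * \<zeta> ^ n \<le> \<Gamma> * q ^ n" using \<Gamma> pow by (intro mult_left_mono) auto
    moreover have "0 \<le> \<Gamma>1 * q ^ n" "0 \<le> \<Gamma> * q ^ n" using pow G1(1) \<Gamma> by auto
    ultimately show ?thesis using G1(2)[of n] gap[of n] by (simp add: distrib_right)
  qed
  then show ?thesis using q G1(1) \<Gamma> by (intro exI[of _ "\<Gamma>1 + \<Gamma>"] conjI exI[of _ q]) auto
qed

lemma polynomial_rate:
  assumes lim: "p \<longlonglongrightarrow> ps" and \<theta>: "1 / 2 < \<theta>" "\<theta> < 1" and KL: "KL_exponent_at \<phi> \<theta> ps"
  shows "\<exists>\<Gamma>>0. \<forall>n. norm (p n - ps) \<le> \<Gamma> * real (Suc n) powr (- (1 - \<theta>) / (2 * \<theta> - 1))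
           \<and> E n - Es \<le> \<Gamma> * real (Suc n) powr (- (1 - \<theta>) / (2 * \<theta> - 1))"
proof -
  \<comment> \<open>Chosen so that \<open>1 + 1 / \<beta> = 2 * \<theta>\<close>, the exponent of
    the recursion. The gap decays with power \<open>\<beta>\<close>, hence its power
    \<open>1 - \<theta>\<close> and the distance with power \<open>\<kappa>\<close>.\<close>
  define \<beta> where "\<beta> = 1 / (2 * \<theta> - 1)"
  define \<kappa> where "\<kappa> = (1 - \<theta>) * \<beta>"
  have \<beta>: "\<beta> > 0" "1 + 1 / \<beta> = 2 * \<theta>" using \<theta> by (auto simp: \<beta>_def)
  have \<kappa>: "0 < \<kappa>" "\<kappa> \<le> \<beta>" "- (1 - \<theta>) / (2 * \<theta> - 1) = - \<kappa>"
    using \<theta> \<beta>(1) by (auto simp: \<kappa>_def \<beta>_def mult_le_cancel_right1 divide_simps)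
  have "0 < \<theta>" using \<theta> by simp
  obtain C N where C: "C > 0" and "\<And>n. n \<ge> N \<Longrightarrow> E n - Es \<le> 1"
    and rec: "\<And>n. n \<ge> N \<Longrightarrow> (E (n + 2) - Es) powr (2 * \<theta>) \<le> C * ((E n - Es) - (E (n + 2) - Es))"
    and dist: "\<And>n. n \<ge> N \<Longrightarrow> norm (p (Suc n) - ps) \<le> C * (E n - Es) powr min (1 / 2) (1 - \<theta>)"
    by (rule exponent_recursion[OF lim \<open>0 < \<theta>\<close> \<theta>(2) KL]) (rule that)
  obtain \<Gamma> where gap: "\<And>n. E n - Es \<le> \<Gamma> * real (Suc n) powr (- \<beta>)"
    using polynomial_decay[OF decseq_gap gap_nonneg C \<beta>(1), of N] rec unfolding \<beta>(2) by blast
  have \<Gamma>: "\<Gamma> \<ge> 0" using gap[of 0] gap_nonneg[of 0] by simp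
  have "norm (p n - ps) \<le> (C * \<Gamma> powr (1 - \<theta>) * 2 powr \<kappa>) * real (Suc n) powr (- \<kappa>)" if n: "n \<ge> Suc N" for n
  proof -
    obtain m where m: "n = Suc m" "m \<ge> N" using n by (cases n) auto
    have "norm (p (Suc m) - ps) \<le> C * (E m - Es) powr (1 - \<theta>)"
      using dist[OF m(2)] \<theta> by (simp add: min_def split: if_splits)
    also have "\<dots> \<le> C * (\<Gamma> * real (Suc m) powr (- \<beta>)) powr (1 - \<theta>)"
      using C gap[of m] gap_nonneg[of m] \<theta> by (intro mult_left_mono powr_mono2) auto
    also have "\<dots> = C * \<Gamma> powr (1 - \<theta>) * real (Suc m) powr (- \<kappa>)"
      using \<Gamma> by (simp add: powr_mult powr_powr \<kappa>_def mult.commute)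
    \<comment> \<open>The estimate at \<open>n\<close> uses the gap one index earlier; replacing
      \<open>Suc m = n\<close> by half of \<open>Suc n\<close> costs the factor
      \<open>2 powr \<kappa>\<close>.\<close>
    also have "\<dots> \<le> C * \<Gamma> powr (1 - \<theta>) * (real (Suc n) / 2) powr (- \<kappa>)"
      using C \<kappa> by (intro mult_left_mono powr_mono2') (auto simp: m)
    also have "(real (Suc n) / 2) powr (- \<kappa>) = 2 powr \<kappa> * real (Suc n) powr (- \<kappa>)"
      by (simp add: powr_divide powr_minus field_simps)
    finally show ?thesis by (simp add: m)
  qed
  then have "\<exists>\<Gamma>>0. \<forall>n. norm (p n - ps) \<le> \<Gamma> * real (Suc n) powr (- \<kappa>)"
    by (rule uniform_rate_if_eventual_rate) auto
  then obtain \<Gamma>1 where G1: "\<Gamma>1 > 0" "\<And>n. norm (p n - ps) \<le> \<Gamma>1 * real (Suc n) powr (- \<kappa>)" by blast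
  have "norm (p n - ps) \<le> (\<Gamma>1 + \<Gamma>) * real (Suc n) powr (- \<kappa>)
      \<and> E n - Es \<le> (\<Gamma>1 + \<Gamma>) * real (Suc n) powr (- \<kappa>)" for n
  proof -
    have "\<Gamma> * real (Suc n) powr (- \<beta>) \<le> \<Gamma> * real (Suc n) powr (- \<kappa>)"
      using \<Gamma> \<kappa> by (intro mult_left_mono powr_mono) auto
    moreover have "0 \<le> \<Gamma>1 * real (Suc n) powr (- \<kappa>)" "0 \<le> \<Gamma> * real (Suc n) powr (- \<kappa>)"
      using G1(1) \<Gamma> by auto
    ultimately show ?thesis using G1(2)[of n] gap[of n] by (simp add: distrib_right)
  qed
  then show ?thesis unfolding \<kappa>(3) using G1(1) \<Gamma> by (intro exI[of _ "\<Gamma>1 + \<Gamma>"]) auto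
qed

end

section \<open>The Backward-Douglas--Rachford iteration\<close>

lemma power2_norm_add: "(norm (a + b))\<^sup>2 = (norm a)\<^sup>2 + 2 * inner a b + (norm (b::'a::real_inner))\<^sup>2"
  by (simp add: power2_norm_eq_inner inner_simps inner_commute)

locale BDR =
  fixes f :: "'a::euclidean_space \<Rightarrow> real" and f' :: "'a \<Rightarrow> 'a"
    and g :: "'a \<Rightarrow> real" and h :: "'a \<Rightarrow> ereal"
    and \<rho> L \<nu> \<tau> \<gamma> :: real
    and x y z w :: "nat \<Rightarrow> 'a"
  assumes grad: "\<And>u. (f has_derivative (\<lambda>v. inner (f' u) v)) (at u)"
    and rho: "\<rho> \<ge> 0"
    and weakly_convex: "convex_on UNIV (\<lambda>u. f u + \<rho> / 2 * (norm u)\<^sup>2)"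
    and lip: "L-lipschitz_on UNIV f'"
    and g_cont: "continuous_on UNIV g" and g_conv: "convex_on UNIV g"
    and h_lsc: "lsc h" and h_nonneginf: "\<And>u. h u \<noteq> -\<infinity>" and h_proper: "\<exists>u. h u \<noteq> \<infinity>"
    and coercive: "((\<lambda>u. ereal (f u) + h u - ereal (g u)) \<longlongrightarrow> \<infinity>) at_infinity"
    and nu: "0 < \<nu>" "\<nu> < 2" and tau: "0 < \<tau>"
    and gamma: "0 < \<gamma>"
      "L \<noteq> 0 \<Longrightarrow> \<gamma> < (- \<nu> * \<rho> + sqrt (\<nu>\<^sup>2 * \<rho>\<^sup>2 - 8 * (\<nu> - 2) * L\<^sup>2)) / (4 * L\<^sup>2)"
    and x_step: "\<And>n. is_argmin (\<lambda>u. f u + 1 / (2 * \<gamma>) * (norm (u - y n))\<^sup>2) (x (Suc n))"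
    and w_step: "\<And>n. is_argmin (\<lambda>v. fenchel_conj g v - ereal (inner v (z n))
                                    + ereal (\<tau> / 2 * (norm (v - w n))\<^sup>2)) (w (Suc n))"
    and z_step: "\<And>n. is_argmin (\<lambda>u. h u + ereal (1 / (2 * \<gamma>)
                     * (norm (u - (2 *\<^sub>R x (Suc n) - y n + \<gamma> *\<^sub>R w (Suc n))))\<^sup>2)) (z (Suc n))"
    and y_step: "\<And>n. y (Suc n) = y n + \<nu> *\<^sub>R (z (Suc n) - x (Suc n))"
begin

lemma L_nonneg: "0 \<le> L"
  using lip by (rule lipschitz_on_nonneg)

text \<open>For \<open>L = 0\<close> the step size is unrestricted and \<open>\<rho>\<close> may still be positive; but then \<open>f\<close> is
  affine, so that \<open>\<rho>\<close> can be replaced by \<open>0\<close>.\<close>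

definition \<rho>0 where "\<rho>0 = (if L = 0 then 0 else \<rho>)"

lemma f_lower: "f u + inner (f' u) (v - u) - \<rho>0 / 2 * (norm (v - u))\<^sup>2 \<le> f v"
  using weakly_convex_lower[OF grad weakly_convex, of u v] lipschitz_gradient_lower[OF grad lip, of u v]
  by (auto simp: \<rho>0_def)

text \<open>For \<open>L \<noteq> 0\<close> the bound on \<open>\<gamma>\<close> is the positive
  root of \<open>2 * L\<^sup>2 * t\<^sup>2 + \<rho> * \<nu> * t - (2 - \<nu>)\<close>; for
  \<open>L = 0\<close> only \<open>\<nu> < 2\<close> remains.\<close>

lemma step_size: "\<rho>0 * \<gamma> * \<nu> + 2 * \<gamma>\<^sup>2 * L\<^sup>2 < 2 - \<nu>"
proof (cases "L = 0")
  case True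
  then have "\<rho>0 = 0" unfolding \<rho>0_def by (rule if_P)
  then show ?thesis using nu \<open>L = 0\<close> by (simp only:) simp
next
  case False
  then have L2: "L\<^sup>2 > 0" by simp
  have "4 * L\<^sup>2 * \<gamma> + \<nu> * \<rho> < sqrt (\<nu>\<^sup>2 * \<rho>\<^sup>2 - 8 * (\<nu> - 2) * L\<^sup>2)"
    using gamma(2)[OF False] L2 by (simp add: pos_less_divide_eq algebra_simps)
  moreover have "0 \<le> 4 * L\<^sup>2 * \<gamma> + \<nu> * \<rho>" using gamma(1) nu rho by simp
  ultimately have "(4 * L\<^sup>2 * \<gamma> + \<nu> * \<rho>)\<^sup>2 < \<nu>\<^sup>2 * \<rho>\<^sup>2 - 8 * (\<nu> - 2) * L\<^sup>2"
    by (metis real_less_rsqrt real_sqrt_less_iff real_sqrt_unique)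
  then have "(8 * L\<^sup>2) * (\<rho> * \<gamma> * \<nu> + 2 * \<gamma>\<^sup>2 * L\<^sup>2) < (8 * L\<^sup>2) * (2 - \<nu>)"
    by (simp add: power2_sum power_mult_distrib algebra_simps power2_eq_square)
  then show ?thesis using L2 False by (simp add: \<rho>0_def)
qed

text \<open>Ensures later that the quadratic term of the merit value dominates the error of
  linearising \<open>f\<close>.\<close>

lemma \<gamma>_L_less: "\<gamma> * L < 1"
proof -
  have "0 \<le> \<rho>0 * \<gamma> * \<nu>" using rho gamma nu by (simp add: \<rho>0_def)
  then have "(\<gamma> * L)\<^sup>2 < 1\<^sup>2" using step_size nu by (simp add: power_mult_distrib)
  then show ?thesis by (rule power2_less_imp_less) simp
qed

section \<open>Optimality conditions of the subproblems\<close>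

definition e where "e n = z (Suc n) - x (Suc n)"

lemma y_eq: "y n = x (Suc n) + \<gamma> *\<^sub>R f' (x (Suc n))"
proof -
  let ?x = "x (Suc n)"
  \<comment> \<open>\<open>d\<close> is the gradient at \<open>?x\<close> of the minimised function;
    the derivative along \<open>d\<close> is \<open>inner d d\<close> and must vanish.\<close>
  define d where "d = f' ?x + (1 / \<gamma>) *\<^sub>R (?x - y n)"
  define k where "k t = f (?x + t *\<^sub>R d) + 1 / (2 * \<gamma>) * (norm (?x + t *\<^sub>R d - y n))\<^sup>2" for t
  have k_eq: "k t = f (?x + t *\<^sub>R d)
      + 1 / (2 * \<gamma>) * ((norm (?x - y n))\<^sup>2 + 2 * t * inner (?x - y n) d + t\<^sup>2 * (norm d)\<^sup>2)" for t
  proof -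
    have "?x + t *\<^sub>R d - y n = (?x - y n) + t *\<^sub>R d" by simp
    then show ?thesis unfolding k_def by (simp only: power2_norm_add) (simp add: power_mult_distrib)
  qed
  have "(k has_real_derivative (inner (f' ?x) d + 1 / \<gamma> * inner (?x - y n) d)) (at 0)"
    unfolding k_eq
    by (rule derivative_eq_intros gradient_along_line[OF grad, of ?x d 0, simplified] refl | simp)+
  moreover have "k 0 \<le> k t" for t
    using x_step[of n, unfolded is_argmin_def, rule_format, of "?x + t *\<^sub>R d"] by (simp add: k_def)
  ultimately have "inner (f' ?x) d + 1 / \<gamma> * inner (?x - y n) d = 0"
    by (intro DERIV_local_min[of k _ 0 1]) auto
  then have "inner d d = 0" by (subst d_def) (simp add: inner_add_left)
  then have "d = 0" by (simp only: inner_eq_zero_iff)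
  then have "f' ?x = (1 / \<gamma>) *\<^sub>R (y n - ?x)" by (simp add: d_def algebra_simps add_eq_0_iff2)
  then show ?thesis using gamma by simp
qed

lemma z_eq: "z (Suc n) = x (Suc n) + e n"
  by (simp add: e_def)

lemma y_Suc_eq: "y (Suc n) = x (Suc n) + \<gamma> *\<^sub>R f' (x (Suc n)) + \<nu> *\<^sub>R e n"
  using y_step[of n] y_eq[of n] by (simp add: e_def)

text \<open>Two expressions for \<open>y (Suc n)\<close> are equated: the update rule and the
  optimality of the next x-step.\<close>

lemma nu_e: "\<nu> *\<^sub>R e n = (x (Suc (Suc n)) - x (Suc n)) + \<gamma> *\<^sub>R (f' (x (Suc (Suc n))) - f' (x (Suc n)))"
  using y_Suc_eq[of n] y_eq[of "Suc n"] by (simp add: algebra_simps)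

definition \<delta> where "\<delta> n = norm (x (Suc (Suc n)) - x (Suc n)) + norm (w (Suc (Suc n)) - w (Suc n))"

definition M where "M = (1 + \<gamma> * L) / \<nu>"

lemma M_pos: "M > 0"
  using nu gamma L_nonneg by (auto simp: M_def intro!: divide_pos_pos add_pos_nonneg)

lemma f'_diff_le: "norm (f' u - f' v) \<le> L * norm (u - v)"
  using lipschitz_onD[OF lip, of u v] by (simp add: dist_norm)

lemma e_le: "norm (e n) \<le> M * \<delta> n"
proof -
  let ?d = "x (Suc (Suc n)) - x (Suc n)"
  have "\<nu> * norm (e n) = norm (\<nu> *\<^sub>R e n)" using nu by simp
  also have "\<dots> \<le> norm ?d + norm (\<gamma> *\<^sub>R (f' (x (Suc (Suc n))) - f' (x (Suc n))))"
    unfolding nu_e by (rule norm_triangle_ineq)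
  also have "\<dots> \<le> norm ?d + \<gamma> * (L * norm ?d)"
    using gamma f'_diff_le by (simp add: mult_left_mono)
  also have "\<dots> = (1 + \<gamma> * L) * norm ?d" by (simp add: algebra_simps)
  also have "\<dots> \<le> (1 + \<gamma> * L) * \<delta> n"
    using gamma L_nonneg by (intro mult_left_mono) (auto simp: \<delta>_def)
  finally show ?thesis using nu by (simp add: M_def field_simps)
qed

text \<open>\<open>h\<close> may be infinite at the arbitrary \<open>z 0\<close>, where
  \<open>real_of_ereal\<close> returns 0; only the values \<open>H (Suc n)\<close> occur.\<close>

definition H where "H n = real_of_ereal (h (z n))"

lemma h_z: "h (z (Suc n)) = ereal (H (Suc n))"
proof -
  obtain u where u: "h u \<noteq> \<infinity>" using h_proper by blast
  then have "h (z (Suc n)) \<noteq> \<infinity>"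
    using z_step[of n, unfolded is_argmin_def, rule_format, of u] by auto
  then show ?thesis using h_nonneginf[of "z (Suc n)"] by (cases "h (z (Suc n))") (auto simp: H_def)
qed

lemma z_argmin:
  assumes "h u = ereal r"
  shows "H (Suc n) + 1 / (2 * \<gamma>) * (norm (z (Suc n) - (x (Suc n) - \<gamma> *\<^sub>R f' (x (Suc n)) + \<gamma> *\<^sub>R w (Suc n))))\<^sup>2
       \<le> r + 1 / (2 * \<gamma>) * (norm (u - (x (Suc n) - \<gamma> *\<^sub>R f' (x (Suc n)) + \<gamma> *\<^sub>R w (Suc n))))\<^sup>2"
proof -
  have "2 *\<^sub>R x (Suc n) - y n + \<gamma> *\<^sub>R w (Suc n) = x (Suc n) - \<gamma> *\<^sub>R f' (x (Suc n)) + \<gamma> *\<^sub>R w (Suc n)"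
    by (simp add: y_eq scaleR_2)
  then show ?thesis
    using z_step[of n, unfolded is_argmin_def, rule_format, of u] assms h_z[of n] by simp
qed

text \<open>Expanding the prox inequality around \<open>z (Suc n)\<close> gives a global minorant of
  \<open>h\<close> with quadratic error, the form that \<open>frechet_subdiffI_quadratic\<close>
  takes.\<close>

lemma z_proximal_subgradient:
  "ereal (H (Suc n)) + ereal (inner (w (Suc n) - f' (x (Suc n)) - (1 / \<gamma>) *\<^sub>R e n) (u - z (Suc n))
     - 1 / (2 * \<gamma>) * (norm (u - z (Suc n)))\<^sup>2) \<le> h u"
proof (cases "h u")
  case (real r)
  define c where "c = x (Suc n) - \<gamma> *\<^sub>R f' (x (Suc n)) + \<gamma> *\<^sub>R w (Suc n)"
  have "(norm (u - c))\<^sup>2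
      = (norm (z (Suc n) - c))\<^sup>2 + 2 * inner (z (Suc n) - c) (u - z (Suc n)) + (norm (u - z (Suc n)))\<^sup>2"
    using power2_norm_add[of "z (Suc n) - c" "u - z (Suc n)"] by simp
  then have "H (Suc n) - 1 / \<gamma> * inner (z (Suc n) - c) (u - z (Suc n)) - 1 / (2 * \<gamma>) * (norm (u - z (Suc n)))\<^sup>2 \<le> r"
    using z_argmin[OF real, of n] by (simp add: c_def[symmetric] distrib_left)
  moreover have "w (Suc n) - f' (x (Suc n)) - (1 / \<gamma>) *\<^sub>R e n = - ((1 / \<gamma>) *\<^sub>R (z (Suc n) - c))"
    using gamma by (simp add: c_def e_def algebra_simps)
  ultimately show ?thesis by (simp add: real)
qed (use h_nonneginf in auto)

definition u where "u n = z n - \<tau> *\<^sub>R (w (Suc n) - w n)"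

lemma w_subgradient: "is_subgradient g (u n) (w (Suc n))"
  unfolding u_def using g_conv tau w_step by (rule argmin_conj_subgradient)

definition G where "G n = inner (w (Suc n)) (u n) - g (u n)"

lemma conj_w: "fenchel_conj g (w (Suc n)) = ereal (G n)"
  unfolding G_def using w_subgradient by (rule fenchel_conj_eq)

lemma w_argmin:
  "G (Suc n) - inner (w (Suc (Suc n))) (z (Suc n)) + \<tau> / 2 * (norm (w (Suc (Suc n)) - w (Suc n)))\<^sup>2
     \<le> G n - inner (w (Suc n)) (z (Suc n))"
  using w_step[of "Suc n", unfolded is_argmin_def, rule_format, of "w (Suc n)"] by (simp add: conj_w)

section \<open>The merit function along the iterates\<close>

definition Q :: "'a \<Rightarrow> 'a \<Rightarrow> 'a \<Rightarrow> 'a \<Rightarrow> real" where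
  "Q a b c d = - inner d c + 1 / (2 * \<gamma>) * (norm (a - b))\<^sup>2
     - 1 / (2 * \<gamma>) * (norm (b - c))\<^sup>2 + (1 - \<nu>) / \<gamma> * (norm (a - c))\<^sup>2"

lemma merit_eq: "BDR_merit f h g \<gamma> \<nu> (a, b, c, d) = ereal (f a) + h c + fenchel_conj g d + ereal (Q a b c d)"
  by (simp add: BDR_merit_def Q_def)

text \<open>\<open>Q\<close> is a quadratic form, so this Taylor expansion is exact: the linear
  coefficients are its partial gradients and the remainder is \<open>Q\<close> at the
  increment.\<close>

lemma Q_add:
  "Q (a + a') (b + b') (c + c') (d + d') = Q a b c d
     + inner ((1 / \<gamma>) *\<^sub>R (a - b) + (2 * (1 - \<nu>) / \<gamma>) *\<^sub>R (a - c)) a'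
     + inner ((1 / \<gamma>) *\<^sub>R (c - a)) b'
     + inner (- d + (1 / \<gamma>) *\<^sub>R (b - c) - (2 * (1 - \<nu>) / \<gamma>) *\<^sub>R (a - c)) c'
     - inner c d' + Q a' b' c' d'"
proof -
  define k where "k = 1 / \<gamma>"
  have k: "1 / (2 * \<gamma>) = k / 2" "t / \<gamma> = t * k" for t by (auto simp: k_def)
  show ?thesis
    unfolding Q_def k power2_norm_eq_inner
    by (simp add: inner_simps inner_commute algebra_simps)
qed

text \<open>Turns the remainder in \<open>Q_add\<close> into a quadratic error. The inner product
  costs \<open>1 / 2\<close>; the \<open>3 / \<gamma>\<close> is reached at \<open>c\<close>, which
  occurs in two of the squared distances, and uses \<open>\<nu> - 1 \<le> 1\<close>.\<close>

lemma Q_lower: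
  "- ((1 / 2 + 3 / \<gamma>) * ((norm a)\<^sup>2 + (norm b)\<^sup>2 + (norm c)\<^sup>2 + (norm d)\<^sup>2)) \<le> Q a b c d"
proof -
  have diff: "(norm (s - t))\<^sup>2 \<le> 2 * (norm s)\<^sup>2 + 2 * (norm t)\<^sup>2" for s t :: 'a
    using power2_norm_add[of s t] power2_norm_add[of s "- t"] zero_le_power2[of "norm (s + t)"] by simp
  define k where "k = 1 / \<gamma>"
  have k: "k > 0" "1 / (2 * \<gamma>) = k / 2" "t / \<gamma> = t * k" for t using gamma by (auto simp: k_def)
  have 1: "inner d c \<le> 1 / 2 * (norm c)\<^sup>2 + 1 / 2 * (norm d)\<^sup>2"
    using power2_norm_add[of c "- d"] zero_le_power2[of "norm (c - d)"] by (simp add: inner_commute)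
  have 2: "k / 2 * (norm (b - c))\<^sup>2 \<le> k * (norm b)\<^sup>2 + k * (norm c)\<^sup>2"
    using mult_left_mono[OF diff[of b c], of "k / 2"] k by (simp add: algebra_simps)
  have "(\<nu> - 1) * k * (norm (a - c))\<^sup>2 \<le> k * (norm (a - c))\<^sup>2"
    using k nu by (intro mult_right_mono) auto
  also have "\<dots> \<le> k * (2 * (norm a)\<^sup>2 + 2 * (norm c)\<^sup>2)" using diff[of a c] k by (intro mult_left_mono) auto
  also have "\<dots> = 2 * (k * (norm a)\<^sup>2) + 2 * (k * (norm c)\<^sup>2)" by (simp add: algebra_simps)
  finally have 3: "(\<nu> - 1) * k * (norm (a - c))\<^sup>2 \<le> 2 * (k * (norm a)\<^sup>2) + 2 * (k * (norm c)\<^sup>2)" .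
  have 4: "0 \<le> k / 2 * (norm (a - b))\<^sup>2" "0 \<le> k * (norm a)\<^sup>2" "0 \<le> k * (norm b)\<^sup>2" "0 \<le> k * (norm d)\<^sup>2"
      "0 \<le> (norm a)\<^sup>2" "0 \<le> (norm b)\<^sup>2"
    using k by auto
  have 5: "(1 - \<nu>) * k * (norm (a - c))\<^sup>2 = - ((\<nu> - 1) * k * (norm (a - c))\<^sup>2)" by (simp add: algebra_simps)
  have 6: "- ((1 / 2 + 3 * k) * ((norm a)\<^sup>2 + (norm b)\<^sup>2 + (norm c)\<^sup>2 + (norm d)\<^sup>2))
      = - (1 / 2) * (norm a)\<^sup>2 - 1 / 2 * (norm b)\<^sup>2 - 1 / 2 * (norm c)\<^sup>2 - 1 / 2 * (norm d)\<^sup>2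
        - 3 * (k * (norm a)\<^sup>2) - 3 * (k * (norm b)\<^sup>2) - 3 * (k * (norm c)\<^sup>2) - 3 * (k * (norm d)\<^sup>2)"
    by (simp add: algebra_simps)
  show ?thesis unfolding Q_def k 5 6 using 1 2 3 4 by linarith
qed

text \<open>Index 0 is the first iterate that the algorithm produces. The starting values satisfy no
  optimality condition, and the merit function may be infinite there.\<close>

definition p where "p n = (x (Suc n), y (Suc n), z (Suc n), w (Suc n))"

definition E where
  "E n = f (x (Suc n)) + H (Suc n) + G n + Q (x (Suc n)) (y (Suc n)) (z (Suc n)) (w (Suc n))"

lemma merit_p: "BDR_merit f h g \<gamma> \<nu> (p n) = ereal (E n)"
  by (simp add: p_def merit_eq h_z conj_w E_def)

text \<open>On iterates \<open>y\<close> can be eliminated and \<open>\<nu>\<close> cancels: the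
  value is the linearisation of \<open>f\<close> at \<open>x\<close> with a proximal term, evaluated
  at \<open>z\<close>, plus \<open>h\<close> and the part involving \<open>w\<close>.\<close>

lemma E_eq: "E n = f (x (Suc n)) + inner (f' (x (Suc n))) (e n) + 1 / (2 * \<gamma>) * (norm (e n))\<^sup>2
     + H (Suc n) + (G n - inner (w (Suc n)) (z (Suc n)))"
proof -
  have expand: "(norm (\<gamma> *\<^sub>R a + c *\<^sub>R b))\<^sup>2 = \<gamma>\<^sup>2 * (norm a)\<^sup>2 + 2 * \<gamma> * c * inner a b + c\<^sup>2 * (norm b)\<^sup>2"
    for a b :: 'a and c
    by (simp add: power2_norm_add power_mult_distrib)
  have "1 / (2 * \<gamma>) * (norm (\<gamma> *\<^sub>R f' (x (Suc n)) + \<nu> *\<^sub>R e n))\<^sup>2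
      - 1 / (2 * \<gamma>) * (norm (\<gamma> *\<^sub>R f' (x (Suc n)) + (\<nu> - 1) *\<^sub>R e n))\<^sup>2 + (1 - \<nu>) / \<gamma> * (norm (e n))\<^sup>2
      = inner (f' (x (Suc n))) (e n) + 1 / (2 * \<gamma>) * (norm (e n))\<^sup>2"
    unfolding expand using gamma(1) by (simp add: power2_eq_square field_simps)
  moreover have "norm (x (Suc n) - y (Suc n)) = norm (\<gamma> *\<^sub>R f' (x (Suc n)) + \<nu> *\<^sub>R e n)"
    by (subst norm_minus_commute) (simp add: y_Suc_eq algebra_simps)
  moreover have "norm (y (Suc n) - z (Suc n)) = norm (\<gamma> *\<^sub>R f' (x (Suc n)) + (\<nu> - 1) *\<^sub>R e n)"
    by (simp add: y_Suc_eq z_eq algebra_simps)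
  moreover have "norm (x (Suc n) - z (Suc n)) = norm (e n)"
    by (subst norm_minus_commute) (simp add: e_def)
  ultimately show ?thesis by (simp add: E_def Q_def)
qed

text \<open>Equal to \<open>(1 - \<gamma>\<^sup>2 * L\<^sup>2) / (\<nu> * \<gamma>) - 1 / (2 *
  \<gamma>) - \<rho>0 / 2\<close>, the coefficient left in \<open>E_decrease\<close>; its numerator
  is the slack in \<open>step_size\<close>.\<close>

definition \<alpha> where "\<alpha> = (2 - \<nu> - \<rho>0 * \<gamma> * \<nu> - 2 * \<gamma>\<^sup>2 * L\<^sup>2) / (2 * \<gamma> * \<nu>)"

lemma \<alpha>_pos: "\<alpha> > 0"
  using step_size gamma(1) nu by (simp add: \<alpha>_def)

text \<open>The comparisons follow the algorithm: the new \<open>w\<close> against the old one at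
  the old \<open>z\<close>, then the new \<open>z\<close> against the old one at the new
  \<open>w\<close>, and \<open>f\<close> between new and old \<open>x\<close>. Only mixed products
  with \<open>e n\<close> remain.\<close>

lemma E_decrease:
  "\<alpha> * (norm (x (Suc (Suc n)) - x (Suc n)))\<^sup>2 + \<tau> / 2 * (norm (w (Suc (Suc n)) - w (Suc n)))\<^sup>2
     \<le> E n - E (Suc n)"
proof -
  define x1 x2 w1 w2 z1 z2 where "x1 = x (Suc n)" and "x2 = x (Suc (Suc n))" and "w1 = w (Suc n)"
    and "w2 = w (Suc (Suc n))" and "z1 = z (Suc n)" and "z2 = z (Suc (Suc n))"
  note defs = this
  define d q where "d = x2 - x1" and "q = f' x2 - f' x1"
  define T where "T = (norm (e n - d))\<^sup>2"
  have z1: "z1 = x1 + e n" and z2: "z2 = x2 + e (Suc n)" and x2: "x2 = x1 + d"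
    by (simp_all add: defs z_eq d_def)
  have E1: "E n = f x1 + inner (f' x1) (e n) + 1 / (2 * \<gamma>) * (norm (e n))\<^sup>2 + H (Suc n) + (G n - inner w1 z1)"
    and E2: "E (Suc n) = f x2 + inner (f' x2) (e (Suc n)) + 1 / (2 * \<gamma>) * (norm (e (Suc n)))\<^sup>2
      + H (Suc (Suc n)) + (G (Suc n) - inner w2 z2)"
    unfolding E_eq by (simp_all add: defs)
  have 1: "G (Suc n) - inner w2 z1 + \<tau> / 2 * (norm (w2 - w1))\<^sup>2 \<le> G n - inner w1 z1"
    using w_argmin[of n] by (simp add: defs)
  have sq: "1 / (2 * \<gamma>) * (norm (a + \<gamma> *\<^sub>R b))\<^sup>2 = 1 / (2 * \<gamma>) * (norm a)\<^sup>2 + inner a b + \<gamma> / 2 * (norm b)\<^sup>2"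
    for a b :: 'a
    unfolding power2_norm_add using gamma(1) by (simp add: power_mult_distrib field_simps) (simp add: power2_eq_square)
  have prox_arg: "z2 - (x2 - \<gamma> *\<^sub>R f' x2 + \<gamma> *\<^sub>R w2) = e (Suc n) + \<gamma> *\<^sub>R (f' x2 - w2)"
    "z1 - (x2 - \<gamma> *\<^sub>R f' x2 + \<gamma> *\<^sub>R w2) = (e n - d) + \<gamma> *\<^sub>R (f' x2 - w2)"
    by (simp_all add: z1 z2 x2 algebra_simps)
  have 2: "H (Suc (Suc n)) + 1 / (2 * \<gamma>) * (norm (e (Suc n)))\<^sup>2 + inner (e (Suc n)) (f' x2 - w2)
      \<le> H (Suc n) + 1 / (2 * \<gamma>) * T + inner (e n - d) (f' x2 - w2)"
    using z_argmin[OF h_z, of "Suc n" n, folded defs] unfolding prox_arg sq T_def by simp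
  have 3: "inner (e (Suc n)) (f' x2 - w2) = inner (f' x2) (e (Suc n)) - inner w2 z2 + inner w2 x2"
    "inner (e n - d) (f' x2 - w2) = inner (f' x2) (e n - d) - inner w2 z1 + inner w2 x2"
    by (simp_all add: z1 z2 x2 inner_simps inner_commute)
  have 4: "f x2 \<le> f x1 + inner (f' x2) d + \<rho>0 / 2 * (norm d)\<^sup>2"
  proof -
    have "x1 - x2 = - d" by (simp add: d_def)
    then show ?thesis using f_lower[of x2 x1] by simp
  qed
  have 5: "1 / (2 * \<gamma>) * T = 1 / (2 * \<gamma>) * (norm (e n))\<^sup>2 - 1 / \<gamma> * inner d (e n) + 1 / (2 * \<gamma>) * (norm d)\<^sup>2"
    using power2_norm_add[of "e n" "- d"] gamma(1) unfolding T_def by (simp add: inner_commute field_simps)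
  have ne: "\<nu> *\<^sub>R e n = d + \<gamma> *\<^sub>R q" using nu_e[of n] by (simp add: d_def q_def defs)
  \<comment> \<open>The identity \<open>ne\<close> turns the mixed products into a difference of
    squares, which the Lipschitz bound reduces to a multiple of
    \<open>(norm d)\<^sup>2\<close>.\<close>
  have "\<nu> * (\<gamma> * inner q (e n) - inner d (e n)) = inner (\<gamma> *\<^sub>R q - d) (\<nu> *\<^sub>R e n)"
    by (simp add: inner_diff_left)
  also have "\<dots> = \<gamma>\<^sup>2 * (norm q)\<^sup>2 - (norm d)\<^sup>2"
    unfolding ne power2_norm_eq_inner by (simp add: inner_simps inner_commute power2_eq_square)
  also have "\<dots> \<le> \<gamma>\<^sup>2 * (L\<^sup>2 * (norm d)\<^sup>2) - (norm d)\<^sup>2"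
  proof -
    have "(norm q)\<^sup>2 \<le> (L * norm d)\<^sup>2" unfolding q_def d_def by (intro power_mono f'_diff_le) simp
    then show ?thesis by (intro diff_right_mono mult_left_mono) (auto simp: power_mult_distrib)
  qed
  finally have "\<nu> * (\<gamma> * inner q (e n) - inner d (e n)) / (\<nu> * \<gamma>)
      \<le> (\<gamma>\<^sup>2 * (L\<^sup>2 * (norm d)\<^sup>2) - (norm d)\<^sup>2) / (\<nu> * \<gamma>)"
    by (rule divide_right_mono) (use gamma(1) nu in simp)
  moreover have "\<nu> * (\<gamma> * inner q (e n) - inner d (e n)) / (\<nu> * \<gamma>) = inner q (e n) - 1 / \<gamma> * inner d (e n)"
    using gamma(1) nu by (simp add: diff_divide_distrib)
  moreover have "(\<gamma>\<^sup>2 * (L\<^sup>2 * (norm d)\<^sup>2) - (norm d)\<^sup>2) / (\<nu> * \<gamma>)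
      = (\<gamma>\<^sup>2 * L\<^sup>2 - 1) / (\<nu> * \<gamma>) * (norm d)\<^sup>2"
    by (simp add: left_diff_distrib)
  moreover have "\<alpha> * (norm d)\<^sup>2
      = - (\<rho>0 / 2 * (norm d)\<^sup>2) - 1 / (2 * \<gamma>) * (norm d)\<^sup>2 - (\<gamma>\<^sup>2 * L\<^sup>2 - 1) / (\<nu> * \<gamma>) * (norm d)\<^sup>2"
    unfolding \<alpha>_def using gamma(1) nu(1) by (simp add: field_simps power2_eq_square)
  moreover have "inner (f' x2) (e n - d) = inner (f' x1) (e n) + inner q (e n) - inner (f' x2) d"
    by (simp add: q_def inner_simps)
  ultimately have "\<alpha> * (norm d)\<^sup>2 + \<tau> / 2 * (norm (w2 - w1))\<^sup>2 \<le> E n - E (Suc n)"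
    unfolding E1 E2 using 1 2[unfolded 3 5] 4 by linarith
  then show ?thesis by (simp add: d_def defs)
qed

text \<open>The halving pays for \<open>(a + b)\<^sup>2 \<le> 2 * a\<^sup>2 + 2 * b\<^sup>2\<close>,
  since \<open>\<delta>\<close> is a sum of two norms.\<close>

definition A where "A = min \<alpha> (\<tau> / 2) / 2"

lemma A_pos: "A > 0"
  using \<alpha>_pos tau by (simp add: A_def)

lemma \<delta>_nonneg: "0 \<le> \<delta> n"
  by (simp add: \<delta>_def)

lemma E_decrease_\<delta>: "A * (\<delta> n)\<^sup>2 \<le> E n - E (Suc n)"
proof -
  define a b where "a = norm (x (Suc (Suc n)) - x (Suc n))" and "b = norm (w (Suc (Suc n)) - w (Suc n))"
  have "(a + b)\<^sup>2 \<le> 2 * a\<^sup>2 + 2 * b\<^sup>2" using zero_le_power2[of "a - b"] by (simp add: power2_sum power2_diff)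
  then have "A * (a + b)\<^sup>2 \<le> A * (2 * a\<^sup>2 + 2 * b\<^sup>2)" using A_pos by (intro mult_left_mono) auto
  also have "\<dots> = min \<alpha> (\<tau> / 2) * a\<^sup>2 + min \<alpha> (\<tau> / 2) * b\<^sup>2" by (simp add: A_def algebra_simps)
  also have "\<dots> \<le> \<alpha> * a\<^sup>2 + \<tau> / 2 * b\<^sup>2" by (intro add_mono mult_right_mono) auto
  finally show ?thesis using E_decrease[of n] by (simp add: \<delta>_def a_def b_def)
qed

text \<open>The blockwise gradient of the merit function, with the proximal subgradient of
  \<open>h\<close> and with \<open>u n\<close> as subgradient of the conjugate. The gradient of
  \<open>f\<close> and the \<open>w\<close> terms cancel, leaving only vanishing quantities.\<close>

definition s where
  "s n = (((\<nu> - 2) / \<gamma>) *\<^sub>R e n, (1 / \<gamma>) *\<^sub>R e n, (- \<nu> / \<gamma>) *\<^sub>R e n, u n - z (Suc n))"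

definition B where "B = 5 * M / \<gamma> + 3 * M + 3 + \<tau>"

lemma B_pos: "B > 0"
  using M_pos gamma(1) tau by (simp add: B_def add_pos_pos)

lemma norm_4_le: "norm (a, b, c, d) \<le> norm a + norm b + norm c + norm d"
  using norm_Pair_le[of a "(b, c, d)"] norm_Pair_le[of b "(c, d)"] norm_Pair_le[of c d] by linarith

lemma z_diff_le: "norm (z (Suc (Suc n)) - z (Suc n)) \<le> M * \<delta> (Suc n) + M * \<delta> n + \<delta> n"
proof -
  have eq: "z (Suc (Suc n)) - z (Suc n) = e (Suc n) - e n + (x (Suc (Suc n)) - x (Suc n))" by (simp add: e_def)
  have "norm (z (Suc (Suc n)) - z (Suc n))
      \<le> norm (e (Suc n)) + norm (e n) + norm (x (Suc (Suc n)) - x (Suc n))"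
    unfolding eq by (rule order_trans[OF norm_triangle_ineq add_right_mono[OF norm_triangle_ineq4]])
  also have "\<dots> \<le> M * \<delta> (Suc n) + M * \<delta> n + \<delta> n"
    by (intro add_mono e_le) (simp add: \<delta>_def)
  finally show ?thesis .
qed

text \<open>The last block compares \<open>z\<close> and \<open>w\<close> with the preceding
  iterate, which costs \<open>\<delta> n\<close>; at index 0 it would involve the starting
  values.\<close>

lemma s_le: "norm (s (Suc n)) \<le> B * (\<delta> n + \<delta> (Suc n))"
proof -
  let ?e = "norm (e (Suc n))"
  have "u (Suc n) - z (Suc (Suc n))
      = (z (Suc n) - z (Suc (Suc n))) - \<tau> *\<^sub>R (w (Suc (Suc n)) - w (Suc n))"
    by (simp add: u_def)
  then have "norm (u (Suc n) - z (Suc (Suc n)))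
      \<le> norm (z (Suc n) - z (Suc (Suc n))) + norm (\<tau> *\<^sub>R (w (Suc (Suc n)) - w (Suc n)))"
    by (simp only: norm_triangle_ineq4)
  also have "\<dots> = norm (z (Suc (Suc n)) - z (Suc n)) + \<tau> * norm (w (Suc (Suc n)) - w (Suc n))"
    using tau by (simp add: norm_minus_commute)
  also have "\<dots> \<le> (M * \<delta> (Suc n) + M * \<delta> n + \<delta> n) + \<tau> * \<delta> n"
    using tau by (intro add_mono z_diff_le mult_left_mono) (auto simp: \<delta>_def)
  finally have 1: "norm (u (Suc n) - z (Suc (Suc n))) \<le> M * \<delta> (Suc n) + M * \<delta> n + \<delta> n + \<tau> * \<delta> n" .
  have "norm (((\<nu> - 2) / \<gamma>) *\<^sub>R e (Suc n)) + norm ((1 / \<gamma>) *\<^sub>R e (Suc n)) + norm ((- \<nu> / \<gamma>) *\<^sub>R e (Suc n))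
      = (2 - \<nu> + 1 + \<nu>) / \<gamma> * ?e"
    using nu gamma(1) by (simp add: field_simps)
  also have "\<dots> \<le> 5 / \<gamma> * (M * \<delta> (Suc n))"
    using gamma(1) e_le[of "Suc n"] M_pos \<delta>_nonneg by (intro mult_mono divide_right_mono) auto
  finally have "norm (s (Suc n)) \<le> 5 / \<gamma> * (M * \<delta> (Suc n)) + (M * \<delta> (Suc n) + M * \<delta> n + \<delta> n + \<tau> * \<delta> n)"
    using 1 norm_4_le[of "((\<nu> - 2) / \<gamma>) *\<^sub>R e (Suc n)" "(1 / \<gamma>) *\<^sub>R e (Suc n)"
      "(- \<nu> / \<gamma>) *\<^sub>R e (Suc n)" "u (Suc n) - z (Suc (Suc n))"] unfolding s_def by linarith
  also have "\<dots> = (5 * M / \<gamma> + M) * \<delta> (Suc n) + (M + 1 + \<tau>) * \<delta> n" by (simp add: algebra_simps)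
  also have "\<dots> \<le> B * \<delta> (Suc n) + B * \<delta> n"
    using M_pos gamma(1) tau \<delta>_nonneg by (intro add_mono mult_right_mono) (auto simp: B_def)
  finally show ?thesis by (simp add: algebra_simps)
qed

lemma p_diff_le: "norm (p (Suc n) - p n) \<le> B * (\<delta> n + \<delta> (Suc n))"
proof -
  have "norm (y (Suc (Suc n)) - y (Suc n)) = \<nu> * norm (e (Suc n))"
    using y_step[of "Suc n"] nu by (simp flip: e_def)
  also have "\<dots> \<le> 2 * (M * \<delta> (Suc n))" using nu e_le by (intro mult_mono) auto
  finally have "norm (p (Suc n) - p n)
      \<le> \<delta> n + 2 * (M * \<delta> (Suc n)) + (M * \<delta> (Suc n) + M * \<delta> n + \<delta> n) + \<delta> n"
    using norm_4_le[of "x (Suc (Suc n)) - x (Suc n)" "y (Suc (Suc n)) - y (Suc n)"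
        "z (Suc (Suc n)) - z (Suc n)" "w (Suc (Suc n)) - w (Suc n)"] z_diff_le[of n]
    by (simp add: p_def) (smt (verit) \<delta>_def norm_ge_zero)
  also have "\<dots> = (3 * M) * \<delta> (Suc n) + (M + 3) * \<delta> n" by (simp add: algebra_simps)
  also have "\<dots> \<le> B * \<delta> (Suc n) + B * \<delta> n"
    using M_pos gamma(1) tau \<delta>_nonneg by (intro add_mono mult_right_mono) (auto simp: B_def)
  finally show ?thesis by (simp add: algebra_simps)
qed

lemma s_subgradient: "s n \<in> frechet_subdiff (BDR_merit f h g \<gamma> \<nu>) (p n)"
proof (rule frechet_subdiffI_quadratic)
  show "\<bar>BDR_merit f h g \<gamma> \<nu> (p n)\<bar> \<noteq> \<infinity>" by (simp add: merit_p)
next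
  fix t :: "'a \<times> 'a \<times> 'a \<times> 'a"
  define K where "K = L / 2 + 1 / (2 * \<gamma>) + (1 / 2 + 3 / \<gamma>)"
  obtain a b c d where t: "t = (x (Suc n) + a, y (Suc n) + b, z (Suc n) + c, w (Suc n) + d)"
    by (metis add.commute diff_add_cancel prod.collapse)
  let ?p = "f' (x (Suc n))"
  define N where "N = (norm a)\<^sup>2 + (norm b)\<^sup>2 + (norm c)\<^sup>2 + (norm d)\<^sup>2"
  have N: "(norm (t - p n))\<^sup>2 = N" by (simp add: t p_def norm_Pair N_def)
  \<comment> \<open>Minorants of the three functions. The one for the conjugate has no error term:
    it is one of the affine functions in the defining supremum.\<close>
  define F1 H1 G1 where "F1 = f (x (Suc n)) + inner ?p a - L / 2 * (norm a)\<^sup>2"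
    and "H1 = H (Suc n) + (inner (w (Suc n) - ?p - (1 / \<gamma>) *\<^sub>R e n) c - 1 / (2 * \<gamma>) * (norm c)\<^sup>2)"
    and "G1 = G n + inner (u n) d"
  have f: "F1 \<le> f (x (Suc n) + a)"
    using lipschitz_gradient_lower[OF grad lip, of "x (Suc n)" "x (Suc n) + a"] by (simp add: F1_def)
  have h: "ereal H1 \<le> h (z (Suc n) + c)"
    using z_proximal_subgradient[of n "z (Suc n) + c"] by (simp add: H1_def)
  have g: "ereal G1 \<le> fenchel_conj g (w (Suc n) + d)"
    using fenchel_conj_ge[of "w (Suc n) + d" "u n" g] by (simp add: G1_def G_def inner_simps inner_commute algebra_simps)
  \<comment> \<open>The gradient of \<open>Q\<close> is written so that \<open>?p\<close> and
    \<open>w (Suc n)\<close> cancel against the linear parts of \<open>F1\<close> and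
    \<open>H1\<close>.\<close>
  have gx: "(1 / \<gamma>) *\<^sub>R (x (Suc n) - y (Suc n)) + (2 * (1 - \<nu>) / \<gamma>) *\<^sub>R (x (Suc n) - z (Suc n))
      = ((\<nu> - 2) / \<gamma>) *\<^sub>R e n - ?p"
    using gamma(1) by (simp add: y_Suc_eq z_eq algebra_simps diff_divide_distrib flip: scaleR_add_left)
  have gz: "- w (Suc n) + (1 / \<gamma>) *\<^sub>R (y (Suc n) - z (Suc n)) - (2 * (1 - \<nu>) / \<gamma>) *\<^sub>R (x (Suc n) - z (Suc n))
      = ?p - w (Suc n) + (1 / \<gamma>) *\<^sub>R e n + (- \<nu> / \<gamma>) *\<^sub>R e n"
    using gamma(1) by (simp add: y_Suc_eq z_eq algebra_simps diff_divide_distrib flip: scaleR_add_left)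
  have q: "Q (x (Suc n)) (y (Suc n)) (z (Suc n)) (w (Suc n)) + inner (((\<nu> - 2) / \<gamma>) *\<^sub>R e n - ?p) a
      + inner ((1 / \<gamma>) *\<^sub>R e n) b + inner (?p - w (Suc n) + (1 / \<gamma>) *\<^sub>R e n + (- \<nu> / \<gamma>) *\<^sub>R e n) c
      - inner (z (Suc n)) d - (1 / 2 + 3 / \<gamma>) * N
      \<le> Q (x (Suc n) + a) (y (Suc n) + b) (z (Suc n) + c) (w (Suc n) + d)"
    unfolding Q_add gx gz e_def[symmetric] using Q_lower[of a b c d] by (simp add: N_def)
  have K: "L / 2 * (norm a)\<^sup>2 + 1 / (2 * \<gamma>) * (norm c)\<^sup>2 + (1 / 2 + 3 / \<gamma>) * N \<le> K * N"
  proof -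
    have "L / 2 * (norm a)\<^sup>2 \<le> L / 2 * N" "1 / (2 * \<gamma>) * (norm c)\<^sup>2 \<le> 1 / (2 * \<gamma>) * N"
      using L_nonneg gamma(1) by (auto simp: N_def intro!: mult_left_mono divide_right_mono)
    then show ?thesis unfolding K_def distrib_right by linarith
  qed
  have "inner (s n) (t - p n) = inner (((\<nu> - 2) / \<gamma>) *\<^sub>R e n) a + inner ((1 / \<gamma>) *\<^sub>R e n) b
      + inner ((- \<nu> / \<gamma>) *\<^sub>R e n) c + inner (u n) d - inner (z (Suc n)) d"
    by (simp add: s_def p_def t inner_diff_left)
  then have "E n + (inner (s n) (t - p n) - K * N) \<le> F1 + H1 + G1 + (
      Q (x (Suc n)) (y (Suc n)) (z (Suc n)) (w (Suc n)) + inner (((\<nu> - 2) / \<gamma>) *\<^sub>R e n - ?p) a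
      + inner ((1 / \<gamma>) *\<^sub>R e n) b + inner (?p - w (Suc n) + (1 / \<gamma>) *\<^sub>R e n + (- \<nu> / \<gamma>) *\<^sub>R e n) c
      - inner (z (Suc n)) d - (1 / 2 + 3 / \<gamma>) * N)"
    unfolding E_def F1_def H1_def G1_def inner_add_left inner_diff_left using K by linarith
  also note add_mono[OF add_mono[OF add_mono[OF f order_refl[of H1]] order_refl[of G1]] q]
  finally have "BDR_merit f h g \<gamma> \<nu> (p n) + ereal (inner (s n) (t - p n) - K * (norm (t - p n))\<^sup>2)
      \<le> ereal (f (x (Suc n) + a)) + ereal H1 + ereal G1
        + ereal (Q (x (Suc n) + a) (y (Suc n) + b) (z (Suc n) + c) (w (Suc n) + d))"
    unfolding merit_p N by simp
  also have "\<dots> \<le> BDR_merit f h g \<gamma> \<nu> t"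
    unfolding t merit_eq by (intro add_mono h g order_refl)
  finally show "BDR_merit f h g \<gamma> \<nu> (p n) + ereal (inner (s n) (t - p n)
      - (L / 2 + 1 / (2 * \<gamma>) + (1 / 2 + 3 / \<gamma>)) * (norm (t - p n))\<^sup>2) \<le> BDR_merit f h g \<gamma> \<nu> t"
    unfolding K_def .
qed

sublocale ds: descent_sequence "BDR_merit f h g \<gamma> \<nu>" p s E \<delta> A B
  by unfold_locales (auto simp: merit_p A_pos B_pos \<delta>_nonneg E_decrease_\<delta> s_subgradient s_le p_diff_le)


section \<open>Boundedness and cluster points of the iterates\<close>

lemma isCont_f: "isCont f t"
  using grad[of t] by (rule has_derivative_continuous)

lemma isCont_f': "isCont f' t"
  using lipschitz_on_continuous_on[OF lip] by (simp add: continuous_on_eq_continuous_at)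

lemma isCont_g: "isCont g t"
  using g_cont by (simp add: continuous_on_eq_continuous_at)

definition Fz where "Fz n = f (z (Suc n)) + H (Suc n) - g (z (Suc n))"

lemma ereal_Fz: "ereal (f (z (Suc n))) + h (z (Suc n)) - ereal (g (z (Suc n))) = ereal (Fz n)"
  by (simp add: h_z Fz_def)

lemma conj_gap_nonneg: "0 \<le> G n + g (z (Suc n)) - inner (w (Suc n)) (z (Suc n))"
  using fenchel_conj_ge[of "w (Suc n)" "z (Suc n)" g] by (simp add: conj_w)

text \<open>The merit value exceeds the objective at \<open>z\<close> by two non-negative gaps: the
  quadratic term minus the linearisation error of \<open>f\<close>, by
  \<open>\<gamma>_L_less\<close>, and the Fenchel-Young gap of \<open>w\<close> and
  \<open>z\<close>.\<close>

lemma Fz_le_E: "Fz n \<le> E n"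
proof -
  have "L \<le> 1 / \<gamma>" using \<gamma>_L_less gamma(1) by (simp add: field_simps)
  then have "L / 2 * (norm (e n))\<^sup>2 \<le> 1 / (2 * \<gamma>) * (norm (e n))\<^sup>2"
    by (intro mult_right_mono) auto
  moreover have "f (z (Suc n)) \<le> f (x (Suc n)) + inner (f' (x (Suc n))) (e n) + L / 2 * (norm (e n))\<^sup>2"
    using lipschitz_gradient_upper[OF grad lip, of "z (Suc n)" "x (Suc n)"] by (simp add: e_def)
  ultimately show ?thesis unfolding E_eq Fz_def using conj_gap_nonneg[of n] by linarith
qed

lemma bounded_z: "bounded (range (\<lambda>n. z (Suc n)))"
proof -
  have "\<forall>\<^sub>F u in at_infinity. ereal (E 0) < ereal (f u) + h u - ereal (g u)"
    using coercive by (simp add: tendsto_PInfty)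
  then obtain R where R: "\<And>u. R \<le> norm u \<Longrightarrow> ereal (E 0) < ereal (f u) + h u - ereal (g u)"
    by (auto simp: eventually_at_infinity)
  have "norm (z (Suc n)) \<le> R" for n
  proof (rule ccontr)
    assume "\<not> ?thesis"
    then have "ereal (E 0) < ereal (Fz n)" using R[of "z (Suc n)"] by (simp add: ereal_Fz)
    moreover have "Fz n \<le> E 0" using Fz_le_E[of n] decseqD[OF ds.decseq_E, of 0 n] by simp
    ultimately show False by simp
  qed
  then show ?thesis by (auto simp: bounded_iff)
qed

text \<open>Coercivity only confines \<open>z\<close> to a ball. There \<open>h\<close> is bounded
  below by semicontinuity and \<open>f - g\<close> by continuity, and the merit value lies above the
  objective.\<close>

lemma E_bounded_below: "\<exists>m. \<forall>n. m \<le> E n"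
proof -
  obtain R where R: "\<And>n. norm (z (Suc n)) \<le> R" using bounded_z by (auto simp: bounded_iff)
  obtain m where m: "\<And>u. u \<in> cball 0 R \<Longrightarrow> ereal m \<le> h u"
    using lsc_bounded_below_on_compact[OF h_lsc h_nonneginf compact_cball] by blast
  have "compact ((\<lambda>u. f u - g u) ` cball 0 R)"
    by (intro compact_continuous_image continuous_at_imp_continuous_on ballI continuous_intros
        isCont_f isCont_g compact_cball)
  then have "bounded ((\<lambda>u. f u - g u) ` cball 0 R)" by (rule compact_imp_bounded)
  then obtain C where C: "\<And>u. u \<in> cball 0 R \<Longrightarrow> \<bar>f u - g u\<bar> \<le> C"
    unfolding bounded_iff by force
  have "m - C \<le> E n" for n
  proof -
    have "z (Suc n) \<in> cball 0 R" using R by simp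
    then have "m \<le> H (Suc n)" "\<bar>f (z (Suc n)) - g (z (Suc n))\<bar> \<le> C"
      using m[of "z (Suc n)"] C[of "z (Suc n)"] by (auto simp: h_z)
    then show ?thesis using Fz_le_E[of n] by (simp add: Fz_def)
  qed
  then show ?thesis by blast
qed

lemma \<delta>_tendsto: "\<delta> \<longlonglongrightarrow> 0"
  using E_bounded_below ds.\<delta>_tendsto_if_bounded_below by blast

lemma e_tendsto: "e \<longlonglongrightarrow> 0"
proof (rule tendsto_norm_zero_cancel, rule tendsto_sandwich[OF _ _ tendsto_const])
  have "(\<lambda>n. M * \<delta> n) \<longlonglongrightarrow> M * 0" by (intro tendsto_intros \<delta>_tendsto)
  then show "(\<lambda>n. M * \<delta> n) \<longlonglongrightarrow> 0" by simp
qed (auto intro!: always_eventually e_le)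

text \<open>The difference is the last block of \<open>s\<close>, so \<open>s_le\<close> controls it
  from index 1 on; hence the shift.\<close>

lemma u_minus_z_tendsto: "(\<lambda>n. u n - z (Suc n)) \<longlonglongrightarrow> 0"
proof (rule LIMSEQ_imp_Suc, rule tendsto_norm_zero_cancel, rule tendsto_sandwich[OF _ _ tendsto_const])
  have "(\<lambda>n. B * (\<delta> n + \<delta> (Suc n))) \<longlonglongrightarrow> B * (0 + 0)"
    by (intro tendsto_intros \<delta>_tendsto LIMSEQ_Suc)
  then show "(\<lambda>n. B * (\<delta> n + \<delta> (Suc n))) \<longlonglongrightarrow> 0" by simp
  have "norm (u (Suc n) - z (Suc (Suc n))) \<le> norm (s (Suc n))" for n
    unfolding s_def by (meson norm_snd_le order_trans)
  then show "\<forall>\<^sub>F n in sequentially. norm (u (Suc n) - z (Suc (Suc n))) \<le> B * (\<delta> n + \<delta> (Suc n))"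
    using s_le by (intro always_eventually allI) (metis order_trans)
qed auto

lemma bounded_u: "bounded (range u)"
proof -
  have "bounded (range (\<lambda>n. (u n - z (Suc n)) + z (Suc n)))"
    by (intro bounded_plus_comp bounded_z convergent_imp_bounded[OF u_minus_z_tendsto])
  then show ?thesis by simp
qed

lemma bounded_w: "bounded (range (\<lambda>n. w (Suc n)))"
proof -
  obtain C where "\<And>t v. t \<in> range u \<Longrightarrow> is_subgradient g t v \<Longrightarrow> norm v \<le> C"
    using subgradients_bounded[OF g_cont bounded_u] by blast
  then have "norm (w (Suc n)) \<le> C" for n using w_subgradient[of n] by blast
  then show ?thesis by (auto simp: bounded_iff)
qed

lemma bounded_p: "bounded (range p)"
proof -
  have "bounded (range (\<lambda>n. z (Suc n) - e n))"
    by (intro bounded_minus_comp bounded_z convergent_imp_bounded[OF e_tendsto])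
  then have x: "bounded (range (\<lambda>n. x (Suc n)))" by (simp add: e_def)
  then obtain R where R: "\<And>n. norm (x (Suc n)) \<le> R" by (auto simp: bounded_iff)
  have "norm (f' (x (Suc n))) \<le> norm (f' 0) + L * R" for n
  proof -
    have "norm (f' (x (Suc n))) \<le> norm (f' 0) + norm (f' (x (Suc n)) - f' 0)"
      by (metis add.commute diff_add_cancel norm_triangle_ineq)
    also have "\<dots> \<le> norm (f' 0) + L * norm (x (Suc n) - 0)" by (intro add_left_mono f'_diff_le)
    also have "\<dots> \<le> norm (f' 0) + L * R" using R L_nonneg by (intro add_left_mono mult_left_mono) auto
    finally show ?thesis .
  qed
  then have "bounded (range (\<lambda>n. f' (x (Suc n))))" by (auto simp: bounded_iff)
  then have "bounded (range (\<lambda>n. x (Suc n) + \<gamma> *\<^sub>R f' (x (Suc n)) + \<nu> *\<^sub>R e n))"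
    by (intro bounded_plus_comp bounded_scaleR_comp x convergent_imp_bounded[OF e_tendsto])
  then have "bounded (range (\<lambda>n. y (Suc n)))" by (simp add: y_Suc_eq)
  with x have "bounded (range (\<lambda>n. x (Suc n)) \<times> range (\<lambda>n. y (Suc n)) \<times> range (\<lambda>n. z (Suc n)) \<times> range (\<lambda>n. w (Suc n)))"
    by (intro bounded_Times bounded_z bounded_w)
  then show ?thesis by (rule bounded_subset) (auto simp: p_def)
qed

text \<open>For the conjugate, Fenchel equality expresses \<open>G\<close> through the continuous
  \<open>g\<close> at \<open>u\<close>. Fenchel equality at the limit, together with
  \<open>xs = zs\<close>, makes the merit value there equal to the objective value.\<close>

lemma cluster_point:
  assumes r: "strict_mono r" and lim: "(\<lambda>k. p (r k)) \<longlonglongrightarrow> (xs, ys, zs, ws)"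
  obtains Es where "(\<lambda>k. E (r k)) \<longlonglongrightarrow> Es" and "BDR_merit f h g \<gamma> \<nu> (xs, ys, zs, ws) = ereal Es"
    and "ereal (f zs) + h zs - ereal (g zs) = ereal Es" and "xs = zs"
    and "ws - f' zs \<in> limiting_subdiff h zs" and "ws \<in> limiting_subdiff (\<lambda>t. ereal (g t)) zs"
proof -
  obtain m where "\<And>n. m \<le> E n" using E_bounded_below by blast
  then obtain Es where "E \<longlonglongrightarrow> Es" using decseq_convergent[OF ds.decseq_E, of m] by metis
  then have Er: "(\<lambda>k. E (r k)) \<longlonglongrightarrow> Es" using LIMSEQ_subseq_LIMSEQ[OF _ r] by (auto simp: comp_def)
  have x: "(\<lambda>k. x (Suc (r k))) \<longlonglongrightarrow> xs" and y: "(\<lambda>k. y (Suc (r k))) \<longlonglongrightarrow> ys"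
    and z: "(\<lambda>k. z (Suc (r k))) \<longlonglongrightarrow> zs" and w: "(\<lambda>k. w (Suc (r k))) \<longlonglongrightarrow> ws"
    using tendsto_fst[OF lim] tendsto_fst[OF tendsto_snd[OF lim]]
      tendsto_fst[OF tendsto_snd[OF tendsto_snd[OF lim]]] tendsto_snd[OF tendsto_snd[OF tendsto_snd[OF lim]]]
    by (simp_all add: p_def)
  have e: "(\<lambda>k. e (r k)) \<longlonglongrightarrow> 0" using LIMSEQ_subseq_LIMSEQ[OF e_tendsto r] by (simp add: comp_def)
  have "(\<lambda>k. x (Suc (r k)) + e (r k)) \<longlonglongrightarrow> xs + 0" by (intro tendsto_add x e)
  then have "(\<lambda>k. z (Suc (r k))) \<longlonglongrightarrow> xs" by (simp add: e_def)
  then have xz: "xs = zs" using z LIMSEQ_unique by blast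
  have "(\<lambda>k. (u (r k) - z (Suc (r k))) + z (Suc (r k))) \<longlonglongrightarrow> 0 + zs"
    using LIMSEQ_subseq_LIMSEQ[OF u_minus_z_tendsto r] by (intro tendsto_add z) (simp add: comp_def)
  then have u: "(\<lambda>k. u (r k)) \<longlonglongrightarrow> zs" by simp
  have gu: "(\<lambda>k. g (u (r k))) \<longlonglongrightarrow> g zs" using u isCont_g isCont_tendsto_compose by blast
  have fx: "(\<lambda>k. f (x (Suc (r k)))) \<longlonglongrightarrow> f zs" using x isCont_f isCont_tendsto_compose xz by blast
  have f'x: "(\<lambda>k. f' (x (Suc (r k)))) \<longlonglongrightarrow> f' zs" using x isCont_f' isCont_tendsto_compose xz by blast
  have sub: "is_subgradient g zs ws"
    unfolding is_subgradient_def
  proof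
    fix t
    have "(\<lambda>k. g (u (r k)) + inner (w (Suc (r k))) (t - u (r k))) \<longlonglongrightarrow> g zs + inner ws (t - zs)"
      by (intro tendsto_intros gu w u)
    then show "g zs + inner ws (t - zs) \<le> g t"
      by (rule LIMSEQ_le_const2) (use w_subgradient in \<open>auto simp: is_subgradient_def\<close>)
  qed
  have G: "(\<lambda>k. G (r k) - inner (w (Suc (r k))) (z (Suc (r k)))) \<longlonglongrightarrow> (inner ws zs - g zs) - inner ws zs"
    unfolding G_def by (intro tendsto_intros w u gu z)
  \<comment> \<open>The limit that \<open>h\<close> must have along the subsequence:
    \<open>E\<close> converges, and so do all other terms of \<open>E_eq\<close>.\<close>
  define Hs where "Hs = Es - (f zs + inner (f' zs) 0 + 1 / (2 * \<gamma>) * (norm (0::'a))\<^sup>2)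
    - ((inner ws zs - g zs) - inner ws zs)"
  have "(\<lambda>k. E (r k) - (f (x (Suc (r k))) + inner (f' (x (Suc (r k)))) (e (r k)) + 1 / (2 * \<gamma>) * (norm (e (r k)))\<^sup>2)
      - (G (r k) - inner (w (Suc (r k))) (z (Suc (r k))))) \<longlonglongrightarrow> Hs"
    unfolding Hs_def by (intro tendsto_diff[OF _ G] tendsto_intros Er fx f'x e)
  then have H: "(\<lambda>k. H (Suc (r k))) \<longlonglongrightarrow> Hs" by (simp add: E_eq)
  then have hz: "(\<lambda>k. h (z (Suc (r k)))) \<longlonglongrightarrow> ereal Hs" by (simp add: h_z)
  have "h zs \<le> ereal Hs" using h_lsc z hz by (rule lsc_tendsto_le)
  then obtain hs where hs: "h zs = ereal hs" "hs \<le> Hs" using h_nonneginf[of zs] by (cases "h zs") auto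
  txt \<open>Comparing the proximal step with \<open>zs\<close> itself bounds \<open>h\<close> along the subsequence from above,
    which turns the semicontinuity estimate \<open>hs \<le> Hs\<close> into an equality.\<close>
  let ?c = "\<lambda>k. x (Suc (r k)) - \<gamma> *\<^sub>R f' (x (Suc (r k))) + \<gamma> *\<^sub>R w (Suc (r k))"
  have c: "?c \<longlonglongrightarrow> zs - \<gamma> *\<^sub>R f' zs + \<gamma> *\<^sub>R ws"
    using x[unfolded xz] by (intro tendsto_intros f'x w)
  have "(\<lambda>k. H (Suc (r k)) + 1 / (2 * \<gamma>) * (norm (z (Suc (r k)) - ?c k))\<^sup>2)
      \<longlonglongrightarrow> Hs + 1 / (2 * \<gamma>) * (norm (zs - (zs - \<gamma> *\<^sub>R f' zs + \<gamma> *\<^sub>R ws)))\<^sup>2"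
    "(\<lambda>k. hs + 1 / (2 * \<gamma>) * (norm (zs - ?c k))\<^sup>2)
      \<longlonglongrightarrow> hs + 1 / (2 * \<gamma>) * (norm (zs - (zs - \<gamma> *\<^sub>R f' zs + \<gamma> *\<^sub>R ws)))\<^sup>2"
    by (intro tendsto_intros H z c)+
  then have "Hs + 1 / (2 * \<gamma>) * (norm (zs - (zs - \<gamma> *\<^sub>R f' zs + \<gamma> *\<^sub>R ws)))\<^sup>2
      \<le> hs + 1 / (2 * \<gamma>) * (norm (zs - (zs - \<gamma> *\<^sub>R f' zs + \<gamma> *\<^sub>R ws)))\<^sup>2"
    by (rule LIMSEQ_le) (use z_argmin[OF hs(1)] in blast)
  then have h: "h zs = ereal Hs" using hs by simp
  have hsub: "ws - f' zs \<in> limiting_subdiff h zs"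
    unfolding limiting_subdiff_def
  proof (intro CollectI exI conjI allI)
    show "(\<lambda>k. z (Suc (r k))) \<longlonglongrightarrow> zs" by (rule z)
    show "(\<lambda>k. h (z (Suc (r k)))) \<longlonglongrightarrow> h zs" using hz by (simp add: h)
    have "(\<lambda>k. w (Suc (r k)) - f' (x (Suc (r k))) - (1 / \<gamma>) *\<^sub>R e (r k)) \<longlonglongrightarrow> ws - f' zs - (1 / \<gamma>) *\<^sub>R 0"
      by (intro tendsto_intros w f'x e)
    then show "(\<lambda>k. w (Suc (r k)) - f' (x (Suc (r k))) - (1 / \<gamma>) *\<^sub>R e (r k)) \<longlonglongrightarrow> ws - f' zs" by simp
    show "w (Suc (r k)) - f' (x (Suc (r k))) - (1 / \<gamma>) *\<^sub>R e (r k) \<in> frechet_subdiff h (z (Suc (r k)))" for k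
      by (rule frechet_subdiffI_quadratic[where K = "1 / (2 * \<gamma>)"])
        (auto simp: h_z simp del: plus_ereal.simps times_divide_eq_left intro: z_proximal_subgradient)
  qed
  have gsub: "ws \<in> limiting_subdiff (\<lambda>t. ereal (g t)) zs"
    by (rule limiting_subdiff_if_frechet, rule frechet_subdiffI_quadratic[where K = 0])
      (use sub in \<open>auto simp: is_subgradient_def\<close>)
  have "ereal (f zs) + h zs - ereal (g zs) = ereal Es" by (simp add: h Hs_def)
  moreover have "BDR_merit f h g \<gamma> \<nu> (xs, ys, zs, ws) = ereal Es"
    unfolding merit_eq xz h fenchel_conj_eq[OF sub] by (simp add: Q_def Hs_def norm_minus_commute)
  ultimately show ?thesis using that[OF Er _ _ xz hsub gsub] by blast
qed

lemma cluster_point_exists: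
  obtains r l where "strict_mono r" "(\<lambda>k. p (r k)) \<longlonglongrightarrow> l"
  using bounded_imp_convergent_subsequence[OF bounded_p] by (auto simp: comp_def)

text \<open>Bounds the two gaps of \<open>Fz_le_E\<close> from above. The distance at
  \<open>n\<close> enters the estimate at \<open>Suc n\<close> because \<open>u (Suc n)\<close> is
  built from \<open>z (Suc n)\<close> and \<open>w (Suc n)\<close>.\<close>

lemma objective_error:
  assumes lim: "p \<longlonglongrightarrow> (zs, ys, zs, ws)"
  obtains C where "C \<ge> 0"
    "\<And>n. \<bar>Fz (Suc n) - Es\<bar>
       \<le> \<bar>E (Suc n) - Es\<bar> + C * (norm (p n - (zs, ys, zs, ws)) + norm (p (Suc n) - (zs, ys, zs, ws)))"
proof -
  define D where "D n = norm (p n - (zs, ys, zs, ws))" for n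
  have comp: "norm (x (Suc n) - zs) \<le> D n" "norm (z (Suc n) - zs) \<le> D n" "norm (w (Suc n) - ws) \<le> D n" for n
  proof -
    have p: "p n - (zs, ys, zs, ws) = (x (Suc n) - zs, y (Suc n) - ys, z (Suc n) - zs, w (Suc n) - ws)"
      by (simp add: p_def)
    show "norm (x (Suc n) - zs) \<le> D n" unfolding D_def p by (rule norm_fst_le)
    show "norm (z (Suc n) - zs) \<le> D n" unfolding D_def p by (meson norm_fst_le norm_snd_le order_trans)
    show "norm (w (Suc n) - ws) \<le> D n" unfolding D_def p by (meson norm_snd_le order_trans)
  qed
  obtain Ce where Ce: "\<And>n. norm (e n) \<le> Ce"
    using convergent_imp_bounded[OF e_tendsto] by (auto simp: bounded_iff)
  obtain Cw where Cw: "\<And>n. norm (w (Suc n)) \<le> Cw" using bounded_w by (auto simp: bounded_iff)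
  obtain Cv where Cv: "\<And>n v. is_subgradient g (z (Suc n)) v \<Longrightarrow> norm v \<le> Cv"
    using subgradients_bounded[OF g_cont bounded_z] by (metis rangeI)
  define C where "C = (L / 2 + 1 / (2 * \<gamma>)) * Ce * 2 + \<bar>Cv + Cw\<bar> * (1 + \<tau>)"
  have Ce0: "0 \<le> Ce" using Ce[of 0] norm_ge_zero order_trans by blast
  have "C \<ge> 0" using Ce0 tau L_nonneg gamma(1) by (simp add: C_def)
  moreover have "\<bar>Fz (Suc n) - Es\<bar> \<le> \<bar>E (Suc n) - Es\<bar> + C * (D n + D (Suc n))" for n
  proof -
    let ?x = "x (Suc (Suc n))" and ?z = "z (Suc (Suc n))" and ?w = "w (Suc (Suc n))" and ?e = "e (Suc n)"
    have D: "0 \<le> D n" "0 \<le> D (Suc n)" by (auto simp: D_def)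
    have "norm ?e \<le> norm (?z - zs) + norm (?x - zs)"
      unfolding e_def using norm_triangle_ineq4[of "?z - zs" "?x - zs"] by simp
    then have e: "norm ?e \<le> 2 * (D n + D (Suc n))" using comp[of "Suc n"] D by argo
    \<comment> \<open>One factor is replaced by the constant \<open>Ce\<close>: a bound linear in
      the distances is enough.\<close>
    have "(norm ?e)\<^sup>2 \<le> Ce * (2 * (D n + D (Suc n)))"
      unfolding power2_eq_square using Ce e Ce0 by (intro mult_mono) auto
    then have "(L / 2 + 1 / (2 * \<gamma>)) * (norm ?e)\<^sup>2 \<le> (L / 2 + 1 / (2 * \<gamma>)) * (Ce * (2 * (D n + D (Suc n))))"
      using L_nonneg gamma(1) by (intro mult_left_mono) auto
    moreover have "f ?x + inner (f' ?x) ?e + 1 / (2 * \<gamma>) * (norm ?e)\<^sup>2 - f ?z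
        \<le> (L / 2 + 1 / (2 * \<gamma>)) * (norm ?e)\<^sup>2"
      using lipschitz_gradient_lower[OF grad lip, of ?x ?z] by (simp add: e_def distrib_right)
    moreover have "G (Suc n) + g ?z - inner ?w ?z \<le> \<bar>Cv + Cw\<bar> * ((1 + \<tau>) * (D n + D (Suc n)))"
    proof -
      \<comment> \<open>A subgradient at \<open>?z\<close> bounds the Fenchel-Young gap by a product
        of a bounded difference of subgradients and the small vector
        \<open>?z - u (Suc n)\<close>.\<close>
      obtain v where v: "is_subgradient g ?z v" using ex_subgradient[OF g_conv] by blast
      have "g ?z + inner v (u (Suc n) - ?z) \<le> g (u (Suc n))" using v by (simp add: is_subgradient_def)
      then have "G (Suc n) + g ?z - inner ?w ?z \<le> inner (v - ?w) (?z - u (Suc n))"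
        by (simp add: G_def inner_simps)
      also have "\<dots> \<le> norm (v - ?w) * norm (?z - u (Suc n))" by (rule norm_cauchy_schwarz)
      also have "\<dots> \<le> \<bar>Cv + Cw\<bar> * ((1 + \<tau>) * (D n + D (Suc n)))"
      proof (rule mult_mono)
        show "norm (v - ?w) \<le> \<bar>Cv + Cw\<bar>"
          using norm_triangle_ineq4[of v ?w] Cv[OF v] Cw[of "Suc n"] by linarith
        have "?z - u (Suc n) = ((?z - zs) - (z (Suc n) - zs)) + \<tau> *\<^sub>R ((?w - ws) - (w (Suc n) - ws))"
          by (simp add: u_def)
        then have "norm (?z - u (Suc n))
            \<le> norm ((?z - zs) - (z (Suc n) - zs)) + norm (\<tau> *\<^sub>R ((?w - ws) - (w (Suc n) - ws)))"
          by (simp only: norm_triangle_ineq)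
        also have "\<dots> \<le> (norm (?z - zs) + norm (z (Suc n) - zs)) + \<tau> * (norm (?w - ws) + norm (w (Suc n) - ws))"
          using tau unfolding norm_scaleR by (intro add_mono norm_triangle_ineq4 mult_mono) auto
        also have "\<dots> \<le> (D (Suc n) + D n) + \<tau> * (D (Suc n) + D n)"
          using tau by (intro add_mono mult_left_mono comp) auto
        finally show "norm (?z - u (Suc n)) \<le> (1 + \<tau>) * (D n + D (Suc n))" by (simp add: algebra_simps)
      qed auto
      finally show ?thesis .
    qed
    moreover have "C * (D n + D (Suc n)) = (L / 2 + 1 / (2 * \<gamma>)) * (Ce * (2 * (D n + D (Suc n))))
        + \<bar>Cv + Cw\<bar> * ((1 + \<tau>) * (D n + D (Suc n)))"
      unfolding C_def by (simp only: distrib_right mult.assoc)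
    ultimately have "E (Suc n) - Fz (Suc n) \<le> C * (D n + D (Suc n))"
      unfolding E_eq Fz_def by linarith
    then show ?thesis using Fz_le_E[of "Suc n"] by linarith
  qed
  ultimately show ?thesis using that unfolding D_def by blast
qed

text \<open>\<open>objective_error\<close> involves the previous iterate, so the rate must not fall
  too fast in one step; \<open>\<kappa>\<close> expresses this. Index 0, without predecessor, is
  absorbed into the constant.\<close>

lemma objective_rate:
  fixes R :: "nat \<Rightarrow> real"
  assumes lim: "p \<longlonglongrightarrow> (zs, ys, zs, ws)" and R: "\<And>n. R n > 0" and \<kappa>: "\<And>n. R n \<le> \<kappa> * R (Suc n)"
    and ge: "\<And>n. Es \<le> E n" and \<Gamma>: "\<Gamma> > 0"
    and rate: "\<And>n. norm (p n - (zs, ys, zs, ws)) \<le> \<Gamma> * R n \<and> E n - Es \<le> \<Gamma> * R n"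
  shows "\<exists>\<Gamma>>0. \<forall>n. norm (p n - (zs, ys, zs, ws)) \<le> \<Gamma> * R n \<and> \<bar>Fz n - Es\<bar> \<le> \<Gamma> * R n"
proof -
  obtain C where C: "C \<ge> 0" "\<And>n. \<bar>Fz (Suc n) - Es\<bar>
      \<le> \<bar>E (Suc n) - Es\<bar> + C * (norm (p n - (zs, ys, zs, ws)) + norm (p (Suc n) - (zs, ys, zs, ws)))"
    using objective_error[OF lim] by blast
  have "\<bar>Fz n - Es\<bar> \<le> (\<Gamma> + C * (\<Gamma> * \<kappa> + \<Gamma>)) * R n" if n: "n \<ge> 1" for n
  proof -
    obtain m where m: "n = Suc m" using n by (cases n) auto
    have "norm (p m - (zs, ys, zs, ws)) \<le> \<Gamma> * (\<kappa> * R n)"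
      using rate[of m] \<kappa>[of m] \<Gamma> m by (meson mult_left_mono less_imp_le order_trans)
    then have "C * (norm (p m - (zs, ys, zs, ws)) + norm (p n - (zs, ys, zs, ws)))
        \<le> C * (\<Gamma> * (\<kappa> * R n) + \<Gamma> * R n)"
      using rate[of n] C(1) by (intro mult_left_mono add_mono) auto
    moreover have "\<bar>E n - Es\<bar> \<le> \<Gamma> * R n" using rate[of n] ge[of n] by simp
    ultimately have "\<bar>Fz n - Es\<bar> \<le> \<Gamma> * R n + C * (\<Gamma> * (\<kappa> * R n) + \<Gamma> * R n)" using C(2)[of m] m by simp
    then show ?thesis by (simp add: algebra_simps)
  qed
  then obtain \<Gamma>' where \<Gamma>': "\<Gamma>' > 0" "\<And>n. \<bar>Fz n - Es\<bar> \<le> \<Gamma>' * R n"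
    using uniform_rate_if_eventual_rate[of 1 "\<lambda>n. \<bar>Fz n - Es\<bar>" _ R] R by metis
  have "norm (p n - (zs, ys, zs, ws)) \<le> max \<Gamma> \<Gamma>' * R n \<and> \<bar>Fz n - Es\<bar> \<le> max \<Gamma> \<Gamma>' * R n" for n
    using rate[of n] \<Gamma>'(2)[of n] R[of n] by (auto intro: order_trans[OF _ mult_right_mono])
  then show ?thesis using \<Gamma> by (intro exI[of _ "max \<Gamma> \<Gamma>'"]) auto
qed


section \<open>Convergence and rates for the algorithm\<close>

lemma convergence:
  assumes KL: "KL_function (BDR_merit f h g \<gamma> \<nu>)"
  shows "\<exists>xs ys zs ws. p \<longlonglongrightarrow> (xs, ys, zs, ws) \<and> xs = zs
        \<and> (\<exists>u \<in> limiting_subdiff h zs. \<exists>v \<in> limiting_subdiff (\<lambda>t. ereal (g t)) zs. f' zs + u - v = 0)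
        \<and> summable (\<lambda>n. norm (p (Suc n) - p n))"
proof -
  obtain r l where r: "strict_mono r" and l: "(\<lambda>k. p (r k)) \<longlonglongrightarrow> l" by (rule cluster_point_exists)
  obtain xs ys zs ws where l_eq: "l = (xs, ys, zs, ws)" by (metis prod.collapse)
  obtain Es where Es: "(\<lambda>k. E (r k)) \<longlonglongrightarrow> Es" "BDR_merit f h g \<gamma> \<nu> (xs, ys, zs, ws) = ereal Es"
    and stat: "xs = zs" "ws - f' zs \<in> limiting_subdiff h zs" "ws \<in> limiting_subdiff (\<lambda>t. ereal (g t)) zs"
    using cluster_point[OF r l[unfolded l_eq]] by metis
  interpret descent_cluster "BDR_merit f h g \<gamma> \<nu>" p s E \<delta> A B l Es r
    by unfold_locales (use r l Es in \<open>auto simp: l_eq\<close>)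
  have "KL_at (BDR_merit f h g \<gamma> \<nu>) l" using KL cluster_mem_dom_subdiff by (simp add: KL_function_def)
  from KL_convergence[OF this] have "p \<longlonglongrightarrow> (xs, ys, zs, ws)" "summable (\<lambda>n. norm (p (Suc n) - p n))"
    by (simp_all add: l_eq)
  moreover have "f' zs + (ws - f' zs) - ws = 0" by simp
  ultimately show ?thesis using stat by blast
qed

lemma rates:
  assumes KL: "KL_function_exp (BDR_merit f h g \<gamma> \<nu>) \<theta>" and lim: "p \<longlonglongrightarrow> (xs, ys, zs, ws)"
  obtains Es where "ereal (f zs) + h zs - ereal (g zs) = ereal Es"
    and "\<theta> = 0 \<Longrightarrow> \<exists>N. \<forall>n\<ge>N. p n = (xs, ys, zs, ws)"
    and "0 < \<theta> \<Longrightarrow> \<theta> \<le> 1 / 2 \<Longrightarrow> \<exists>\<Gamma>>0. \<exists>q. 0 < q \<and> q < 1 \<and>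
      (\<forall>n. norm (p n - (xs, ys, zs, ws)) \<le> \<Gamma> * q ^ n \<and> \<bar>Fz n - Es\<bar> \<le> \<Gamma> * q ^ n)"
    and "1 / 2 < \<theta> \<Longrightarrow> \<theta> < 1 \<Longrightarrow> \<exists>\<Gamma>>0. \<forall>n.
      norm (p n - (xs, ys, zs, ws)) \<le> \<Gamma> * real (Suc n) powr (- (1 - \<theta>) / (2 * \<theta> - 1))
      \<and> \<bar>Fz n - Es\<bar> \<le> \<Gamma> * real (Suc n) powr (- (1 - \<theta>) / (2 * \<theta> - 1))"
proof -
  let ?l = "(xs, ys, zs, ws)"
  \<comment> \<open>The given limit is a cluster point along the identity subsequence, so the
    abstract rates apply to it directly.\<close>
  have id: "strict_mono (\<lambda>k::nat. k)" by (simp add: strict_mono_def)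
  obtain Es where Es: "E \<longlonglongrightarrow> Es" "BDR_merit f h g \<gamma> \<nu> ?l = ereal Es"
    and F: "ereal (f zs) + h zs - ereal (g zs) = ereal Es" and xz: "xs = zs"
    using cluster_point[OF id lim] by metis
  interpret descent_cluster "BDR_merit f h g \<gamma> \<nu>" p s E \<delta> A B ?l Es "\<lambda>k. k"
    by unfold_locales (use id lim Es in auto)
  have KL': "KL_exponent_at (BDR_merit f h g \<gamma> \<nu>) \<theta> ?l"
    using KL cluster_mem_dom_subdiff unfolding KL_function_exp_def KL_exponent_at_def by blast
  note lim' = lim[unfolded xz]
  show ?thesis
  proof (rule that[OF F])
    assume "\<theta> = 0"
    with KL' show "\<exists>N. \<forall>n\<ge>N. p n = ?l" using finite_convergence[OF lim] by simp
  next
    assume "0 < \<theta>" "\<theta> \<le> 1 / 2"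
    from geometric_rate[OF lim this KL'] obtain \<Gamma> q where \<Gamma>: "\<Gamma> > 0" and q: "0 < q" "q < 1"
      and rate: "\<And>n. norm (p n - ?l) \<le> \<Gamma> * q ^ n \<and> E n - Es \<le> \<Gamma> * q ^ n" by blast
    have "\<exists>\<Gamma>>0. \<forall>n. norm (p n - (zs, ys, zs, ws)) \<le> \<Gamma> * q ^ n \<and> \<bar>Fz n - Es\<bar> \<le> \<Gamma> * q ^ n"
      by (rule objective_rate[where \<kappa> = "1 / q", OF lim' _ _ E_ge \<Gamma> rate[unfolded xz]]) (use q in auto)
    with q show "\<exists>\<Gamma>>0. \<exists>q. 0 < q \<and> q < 1 \<and>
        (\<forall>n. norm (p n - ?l) \<le> \<Gamma> * q ^ n \<and> \<bar>Fz n - Es\<bar> \<le> \<Gamma> * q ^ n)"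
      unfolding xz by blast
  next
    assume \<theta>: "1 / 2 < \<theta>" "\<theta> < 1"
    define c where "c = - (1 - \<theta>) / (2 * \<theta> - 1)"
    have c: "c \<le> 0" using \<theta> by (simp add: c_def divide_nonpos_pos)
    from polynomial_rate[OF lim \<theta> KL'] obtain \<Gamma> where \<Gamma>: "\<Gamma> > 0"
      and rate: "\<And>n. norm (p n - ?l) \<le> \<Gamma> * real (Suc n) powr c \<and> E n - Es \<le> \<Gamma> * real (Suc n) powr c"
      unfolding c_def by blast
    have \<kappa>: "real (Suc n) powr c \<le> 2 powr (- c) * real (Suc (Suc n)) powr c" for n
    proof -
      have "real (Suc n) powr c \<le> (real (Suc (Suc n)) / 2) powr c" using c by (intro powr_mono2') auto
      also have "\<dots> = 2 powr (- c) * real (Suc (Suc n)) powr c" by (simp add: powr_divide powr_minus field_simps)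
      finally show ?thesis .
    qed
    have "\<exists>\<Gamma>>0. \<forall>n. norm (p n - (zs, ys, zs, ws)) \<le> \<Gamma> * real (Suc n) powr c
        \<and> \<bar>Fz n - Es\<bar> \<le> \<Gamma> * real (Suc n) powr c"
      by (rule objective_rate[OF lim' _ \<kappa> E_ge \<Gamma> rate[unfolded xz]]) simp
    then show "\<exists>\<Gamma>>0. \<forall>n. norm (p n - ?l) \<le> \<Gamma> * real (Suc n) powr (- (1 - \<theta>) / (2 * \<theta> - 1))
        \<and> \<bar>Fz n - Es\<bar> \<le> \<Gamma> * real (Suc n) powr (- (1 - \<theta>) / (2 * \<theta> - 1))"
      unfolding xz c_def .
  qed
qed

end

theorem theorem3p6:
  fixes f :: "'a::euclidean_space \<Rightarrow> real" and f' :: "'a \<Rightarrow> 'a"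
    and g :: "'a \<Rightarrow> real" and h :: "'a \<Rightarrow> ereal"
    and \<rho> L \<nu> \<tau> \<gamma> :: real
    and x y z w :: "nat \<Rightarrow> 'a"
  assumes grad: "\<And>u. (f has_derivative (\<lambda>v. inner (f' u) v)) (at u)"
    and rho: "\<rho> \<ge> 0"
    and weakly_convex: "convex_on UNIV (\<lambda>u. f u + \<rho> / 2 * (norm u)\<^sup>2)"
    and lip: "L-lipschitz_on UNIV f'"
    and g_cont: "continuous_on UNIV g" and g_conv: "convex_on UNIV g"
    and h_lsc: "lsc h" and h_nonneginf: "\<And>u. h u \<noteq> -\<infinity>" and h_proper: "\<exists>u. h u \<noteq> \<infinity>"
    and coercive: "((\<lambda>u. ereal (f u) + h u - ereal (g u)) \<longlongrightarrow> \<infinity>) at_infinity"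
    and nu: "0 < \<nu>" "\<nu> < 2" and tau: "0 < \<tau>"
    and gamma: "0 < \<gamma>"
      "L \<noteq> 0 \<Longrightarrow> \<gamma> < (- \<nu> * \<rho> + sqrt (\<nu>\<^sup>2 * \<rho>\<^sup>2 - 8 * (\<nu> - 2) * L\<^sup>2)) / (4 * L\<^sup>2)"
    and x_step: "\<And>n. is_argmin (\<lambda>u. f u + 1 / (2 * \<gamma>) * (norm (u - y n))\<^sup>2) (x (Suc n))"
    and w_step: "\<And>n. is_argmin (\<lambda>v. fenchel_conj g v - ereal (inner v (z n))
                                    + ereal (\<tau> / 2 * (norm (v - w n))\<^sup>2)) (w (Suc n))"
    and z_step: "\<And>n. is_argmin (\<lambda>u. h u + ereal (1 / (2 * \<gamma>)
                     * (norm (u - (2 *\<^sub>R x (Suc n) - y n + \<gamma> *\<^sub>R w (Suc n))))\<^sup>2)) (z (Suc n))"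
    and y_step: "\<And>n. y (Suc n) = y n + \<nu> *\<^sub>R (z (Suc n) - x (Suc n))"
  shows
    "(KL_function (BDR_merit f h g \<gamma> \<nu>) \<longrightarrow>
       (\<exists>xs ys zs ws.
          (\<lambda>n. (x (Suc n), y (Suc n), z (Suc n), w (Suc n))) \<longlonglongrightarrow> (xs, ys, zs, ws)
        \<and> xs = zs
        \<and> (\<exists>u \<in> limiting_subdiff h zs. \<exists>v \<in> limiting_subdiff (\<lambda>t. ereal (g t)) zs.
              f' zs + u - v = 0)
        \<and> summable (\<lambda>n. norm ((x (Suc (Suc n)), y (Suc (Suc n)), z (Suc (Suc n)), w (Suc (Suc n)))
                              - (x (Suc n), y (Suc n), z (Suc n), w (Suc n))))))
   \<and> (\<forall>\<theta> xs ys zs ws. 0 \<le> \<theta> \<and> \<theta> < 1 \<and> KL_function_exp (BDR_merit f h g \<gamma> \<nu>) \<theta>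
        \<and> (\<lambda>n. (x (Suc n), y (Suc n), z (Suc n), w (Suc n))) \<longlonglongrightarrow> (xs, ys, zs, ws) \<longrightarrow>
        (\<theta> = 0 \<longrightarrow>
           (\<exists>N\<ge>1. \<forall>n\<ge>N. (x n, y n, z n, w n) = (xs, ys, zs, ws)))
      \<and> (0 < \<theta> \<and> \<theta> \<le> 1 / 2 \<longrightarrow>
           (\<exists>\<Gamma> > 0. \<exists>\<zeta>. 0 < \<zeta> \<and> \<zeta> < 1 \<and> (\<forall>n\<ge>1.
              norm ((x n, y n, z n, w n) - (xs, ys, zs, ws)) \<le> \<Gamma> * \<zeta> powr (real n / 2)
            \<and> \<bar>(ereal (f (z n)) + h (z n) - ereal (g (z n))) - (ereal (f zs) + h zs - ereal (g zs))\<bar>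
                \<le> ereal (\<Gamma> * \<zeta> powr (real n / 2)))))
      \<and> (1 / 2 < \<theta> \<and> \<theta> < 1 \<longrightarrow>
           (\<exists>\<Gamma> > 0. \<forall>n\<ge>1.
              norm ((x n, y n, z n, w n) - (xs, ys, zs, ws)) \<le> \<Gamma> * real n powr (- (1 - \<theta>) / (2 * \<theta> - 1))
            \<and> \<bar>(ereal (f (z n)) + h (z n) - ereal (g (z n))) - (ereal (f zs) + h zs - ereal (g zs))\<bar>
                \<le> ereal (\<Gamma> * real n powr (- (1 - \<theta>) / (2 * \<theta> - 1))))))"
proof (intro conjI impI allI)
  interpret BDR f f' g h \<rho> L \<nu> \<tau> \<gamma> x y z w
    using assms by unfold_locales
  {
    assume "KL_function (BDR_merit f h g \<gamma> \<nu>)"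
    from convergence[OF this]
    show "\<exists>xs ys zs ws.
          (\<lambda>n. (x (Suc n), y (Suc n), z (Suc n), w (Suc n))) \<longlonglongrightarrow> (xs, ys, zs, ws)
        \<and> xs = zs
        \<and> (\<exists>u \<in> limiting_subdiff h zs. \<exists>v \<in> limiting_subdiff (\<lambda>t. ereal (g t)) zs.
              f' zs + u - v = 0)
        \<and> summable (\<lambda>n. norm ((x (Suc (Suc n)), y (Suc (Suc n)), z (Suc (Suc n)), w (Suc (Suc n)))
                              - (x (Suc n), y (Suc n), z (Suc n), w (Suc n))))"
      unfolding p_def .
  next
    fix \<theta> xs ys zs ws
    assume *: "0 \<le> \<theta> \<and> \<theta> < 1 \<and> KL_function_exp (BDR_merit f h g \<gamma> \<nu>) \<theta>
        \<and> (\<lambda>n. (x (Suc n), y (Suc n), z (Suc n), w (Suc n))) \<longlonglongrightarrow> (xs, ys, zs, ws)"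
    then have KL: "KL_function_exp (BDR_merit f h g \<gamma> \<nu>) \<theta>" and lim: "p \<longlonglongrightarrow> (xs, ys, zs, ws)"
      unfolding p_def by blast+
    obtain Es where F: "ereal (f zs) + h zs - ereal (g zs) = ereal Es"
      and finite: "\<theta> = 0 \<Longrightarrow> \<exists>N. \<forall>n\<ge>N. p n = (xs, ys, zs, ws)"
      and geometric: "0 < \<theta> \<Longrightarrow> \<theta> \<le> 1 / 2 \<Longrightarrow> \<exists>\<Gamma>>0. \<exists>q. 0 < q \<and> q < 1 \<and>
        (\<forall>n. norm (p n - (xs, ys, zs, ws)) \<le> \<Gamma> * q ^ n \<and> \<bar>Fz n - Es\<bar> \<le> \<Gamma> * q ^ n)"
      and polynomial: "1 / 2 < \<theta> \<Longrightarrow> \<theta> < 1 \<Longrightarrow> \<exists>\<Gamma>>0. \<forall>n.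
        norm (p n - (xs, ys, zs, ws)) \<le> \<Gamma> * real (Suc n) powr (- (1 - \<theta>) / (2 * \<theta> - 1))
        \<and> \<bar>Fz n - Es\<bar> \<le> \<Gamma> * real (Suc n) powr (- (1 - \<theta>) / (2 * \<theta> - 1))"
      by (rule rates[OF KL lim]) (rule that)
    \<comment> \<open>Passes from index \<open>m\<close> to iterate \<open>Suc m\<close>, and from
      the real \<open>Fz\<close> to the extended-real objective, which is finite at the iterates and
      at the limit.\<close>
    have shift: "\<forall>n\<ge>1. norm ((x n, y n, z n, w n) - (xs, ys, zs, ws)) \<le> R n
        \<and> \<bar>(ereal (f (z n)) + h (z n) - ereal (g (z n))) - (ereal (f zs) + h zs - ereal (g zs))\<bar> \<le> ereal (R n)"
      if "\<And>m. norm (p m - (xs, ys, zs, ws)) \<le> R (Suc m) \<and> \<bar>Fz m - Es\<bar> \<le> R (Suc m)" for R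
    proof (intro allI impI)
      fix n :: nat assume "n \<ge> 1"
      then obtain m where "n = Suc m" by (cases n) auto
      then show "norm ((x n, y n, z n, w n) - (xs, ys, zs, ws)) \<le> R n
        \<and> \<bar>(ereal (f (z n)) + h (z n) - ereal (g (z n))) - (ereal (f zs) + h zs - ereal (g zs))\<bar> \<le> ereal (R n)"
        using that[of m] by (simp only: ereal_Fz F p_def) simp
    qed
    {
      assume "\<theta> = 0"
      from finite[OF this] obtain N where "\<And>n. n \<ge> N \<Longrightarrow> p n = (xs, ys, zs, ws)" by blast
      then have "(x n, y n, z n, w n) = (xs, ys, zs, ws)" if "n \<ge> Suc N" for n
        using that by (cases n) (auto simp: p_def)
      then show "\<exists>N\<ge>1. \<forall>n\<ge>N. (x n, y n, z n, w n) = (xs, ys, zs, ws)"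
        by (intro exI[of _ "Suc N"]) auto
    next
      assume "0 < \<theta> \<and> \<theta> \<le> 1 / 2"
      then obtain \<Gamma> q where \<Gamma>: "\<Gamma> > 0" and q: "0 < q" "q < 1"
        and rate: "\<And>n. norm (p n - (xs, ys, zs, ws)) \<le> \<Gamma> * q ^ n \<and> \<bar>Fz n - Es\<bar> \<le> \<Gamma> * q ^ n"
        using geometric by blast
      \<comment> \<open>The rate is stated with exponent \<open>n / 2\<close>, so the base is
        \<open>q\<^sup>2\<close>; dividing \<open>\<Gamma>\<close> by \<open>q\<close> below
        compensates the index shift.\<close>
      have pow: "(q\<^sup>2) powr (real n / 2) = q ^ n" for n
      proof -
        have "(q\<^sup>2) powr (real n / 2) = (q powr 2) powr (real n / 2)" using q by simp
        also have "\<dots> = q powr real n" by (simp only: powr_powr) simp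
        also have "\<dots> = q ^ n" using q(1) by (rule powr_realpow)
        finally show ?thesis .
      qed
      have "\<Gamma> * q ^ m = \<Gamma> / q * (q\<^sup>2) powr (real (Suc m) / 2)" for m
        unfolding pow using q by simp
      then have "\<forall>n\<ge>1. norm ((x n, y n, z n, w n) - (xs, ys, zs, ws)) \<le> \<Gamma> / q * (q\<^sup>2) powr (real n / 2)
        \<and> \<bar>(ereal (f (z n)) + h (z n) - ereal (g (z n))) - (ereal (f zs) + h zs - ereal (g zs))\<bar>
          \<le> ereal (\<Gamma> / q * (q\<^sup>2) powr (real n / 2))"
        using rate by (intro shift) simp
      moreover have "\<Gamma> / q > 0" "0 < q\<^sup>2" "q\<^sup>2 < 1" using \<Gamma> q by (auto simp: power_less_one_iff)
      ultimately show "\<exists>\<Gamma> > 0. \<exists>\<zeta>. 0 < \<zeta> \<and> \<zeta> < 1 \<and> (\<forall>n\<ge>1.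
              norm ((x n, y n, z n, w n) - (xs, ys, zs, ws)) \<le> \<Gamma> * \<zeta> powr (real n / 2)
            \<and> \<bar>(ereal (f (z n)) + h (z n) - ereal (g (z n))) - (ereal (f zs) + h zs - ereal (g zs))\<bar>
                \<le> ereal (\<Gamma> * \<zeta> powr (real n / 2)))"
        by blast
    next
      assume "1 / 2 < \<theta> \<and> \<theta> < 1"
      then obtain \<Gamma> where \<Gamma>: "\<Gamma> > 0" and rate: "\<And>n.
          norm (p n - (xs, ys, zs, ws)) \<le> \<Gamma> * real (Suc n) powr (- (1 - \<theta>) / (2 * \<theta> - 1))
          \<and> \<bar>Fz n - Es\<bar> \<le> \<Gamma> * real (Suc n) powr (- (1 - \<theta>) / (2 * \<theta> - 1))"
        using polynomial by blast
      from shift[OF rate] \<Gamma>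
      show "\<exists>\<Gamma> > 0. \<forall>n\<ge>1.
              norm ((x n, y n, z n, w n) - (xs, ys, zs, ws)) \<le> \<Gamma> * real n powr (- (1 - \<theta>) / (2 * \<theta> - 1))
            \<and> \<bar>(ereal (f (z n)) + h (z n) - ereal (g (z n))) - (ereal (f zs) + h zs - ereal (g zs))\<bar>
                \<le> ereal (\<Gamma> * real n powr (- (1 - \<theta>) / (2 * \<theta> - 1)))"
        by blast
    }
  }
qed

end
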